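(* Let $(X,d)$ and $(Y,l)$ be compact metric spaces and let $T(X)$ and $T(Y)$ be finite approximations of $X$ and $Y$ respectively. Then the set of shape morphisms from $X$ to $Y$ is in bijective correspondence with the set of morphisms in pro-$HTop$ from $T(X)$ to $T(Y)$.
   Context: For a compact metric space $(X,d)$: a finite $A\subset X$ is an $\epsilon$-approximation if every $x\in X$ satisfies $d(x,a)<\epsilon$ for some $a\in A$; $\mathcal{U}_{r}(A)$ is the set of nonempty subsets of $A$ of diameter $<r$, a finite poset under inclusion regarded as a finite $T_0$ space whose open sets are the down-sets. A finite approximation of $X$ is an inverse sequence $(\mathcal{U}_{4\epsilon_n}(A_n),q_{n,n+1})$ where $\epsilon_n>0$, $\epsilon_{n+1}<\epsilon_n/2$, $A_n$ is an $\epsilon_n$-approximation, and $q_{n,n+1}(C)=\bigcup_{c\in C}\mathcal{B}(c,\epsilon_n)\cap A_n$ ($\mathcal{B}$ the open ball). $HTop$ is the homotopy category of topological spaces and pro-$HTop$ its pro-category: a morphism between inverse sequences $(X_n,p_{n,n+1})\to(Y_n,q_{n,n+1})$ is represented by an increasing $f:\mathbb{N}\to\mathbb{N}$ and maps $f_n:X_{f(n)}\to Y_n$ with $q_{n,n+1}\circ f_{n+1}\simeq f_n\circ p_{f(n),f(n+1)}$, two representatives $(f_n,f),(g_n,g)$ being equivalent if for each $n$ some $m\ge f(n),g(n)$ gives $f_n\circ p_{f(n),m}\simeq g_n\circ p_{g(n),m}$. Shape morphisms are those of the usual (Borsuk / Mardešić–Segal) shape category of compact metric spaces. *)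

theory Defs
  imports "HOL-Analysis.Analysis"
begin

definition set_diam :: "('a \<Rightarrow> 'a \<Rightarrow> real) \<Rightarrow> 'a set \<Rightarrow> real" where
  "set_diam d C = Sup ((\<lambda>(a, b). d a b) ` (C \<times> C))"

definition eps_approximation :: "'a set \<Rightarrow> ('a \<Rightarrow> 'a \<Rightarrow> real) \<Rightarrow> real \<Rightarrow> 'a set \<Rightarrow> bool" where
  "eps_approximation X d \<epsilon> A \<longleftrightarrow> finite A \<and> A \<subseteq> X \<and> (\<forall>x\<in>X. \<exists>a\<in>A. d x a < \<epsilon>)"

definition U_r :: "('a \<Rightarrow> 'a \<Rightarrow> real) \<Rightarrow> real \<Rightarrow> 'a set \<Rightarrow> 'a set set" where
  "U_r d r A = {C. C \<subseteq> A \<and> C \<noteq> {} \<and> set_diam d C < r}"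

text \<open>A finite poset (under inclusion) as a finite T0 space: open sets are the down-sets.\<close>
definition downset_topology :: "'a set set \<Rightarrow> 'a set topology" where
  "downset_topology P = topology (\<lambda>S. S \<subseteq> P \<and> (\<forall>C\<in>S. \<forall>D\<in>P. D \<subseteq> C \<longrightarrow> D \<in> S))"

definition finite_approximation ::
  "'a set \<Rightarrow> ('a \<Rightarrow> 'a \<Rightarrow> real) \<Rightarrow> (nat \<Rightarrow> real) \<Rightarrow> (nat \<Rightarrow> 'a set) \<Rightarrow> bool" where
  "finite_approximation X d eps A \<longleftrightarrow>
     (\<forall>n. eps n > 0 \<and> eps (Suc n) < eps n / 2 \<and> eps_approximation X d (eps n) (A n))"

text \<open>The spaces U_{4 eps_n}(A_n) and bonding maps q_{n,n+1} : U_{4eps_{n+1}}(A_{n+1}) -> U_{4 eps_n}(A_n).\<close>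
definition fa_spaces :: "('a \<Rightarrow> 'a \<Rightarrow> real) \<Rightarrow> (nat \<Rightarrow> real) \<Rightarrow> (nat \<Rightarrow> 'a set) \<Rightarrow> nat \<Rightarrow> 'a set topology" where
  "fa_spaces d eps A n = downset_topology (U_r d (4 * eps n) (A n))"

definition fa_bonds :: "('a \<Rightarrow> 'a \<Rightarrow> real) \<Rightarrow> (nat \<Rightarrow> real) \<Rightarrow> (nat \<Rightarrow> 'a set) \<Rightarrow> nat \<Rightarrow> 'a set \<Rightarrow> 'a set" where
  "fa_bonds d eps A n C = (\<Union>c\<in>C. {a \<in> A n. d c a < eps n})"

text \<open>bond p n k = p_{n,n+k} : X_{n+k} -> X_n, where p n : X_{n+1} -> X_n.\<close>
fun bond :: "(nat \<Rightarrow> 'x \<Rightarrow> 'x) \<Rightarrow> nat \<Rightarrow> nat \<Rightarrow> 'x \<Rightarrow> 'x" where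
  "bond p n 0 = id"
| "bond p n (Suc k) = bond p n k \<circ> p (n + k)"

definition bonds :: "(nat \<Rightarrow> 'x \<Rightarrow> 'x) \<Rightarrow> nat \<Rightarrow> nat \<Rightarrow> 'x \<Rightarrow> 'x" where
  "bonds p n m = bond p n (m - n)"

definition pro_reps ::
  "(nat \<Rightarrow> 'x topology) \<Rightarrow> (nat \<Rightarrow> 'x \<Rightarrow> 'x) \<Rightarrow> (nat \<Rightarrow> 'y topology) \<Rightarrow> (nat \<Rightarrow> 'y \<Rightarrow> 'y)
   \<Rightarrow> ((nat \<Rightarrow> nat) \<times> (nat \<Rightarrow> 'x \<Rightarrow> 'y)) set" where
  "pro_reps Xs p Ys q = {(f, fs). mono f \<and>
      (\<forall>n. continuous_map (Xs (f n)) (Ys n) (fs n)) \<and>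
      (\<forall>n. homotopic_with (\<lambda>_. True) (Xs (f (Suc n))) (Ys n)
             (q n \<circ> fs (Suc n)) (fs n \<circ> bonds p (f n) (f (Suc n))))}"

definition pro_equiv ::
  "(nat \<Rightarrow> 'x topology) \<Rightarrow> (nat \<Rightarrow> 'x \<Rightarrow> 'x) \<Rightarrow> (nat \<Rightarrow> 'y topology) \<Rightarrow> (nat \<Rightarrow> 'y \<Rightarrow> 'y)
   \<Rightarrow> (((nat \<Rightarrow> nat) \<times> (nat \<Rightarrow> 'x \<Rightarrow> 'y)) \<times> ((nat \<Rightarrow> nat) \<times> (nat \<Rightarrow> 'x \<Rightarrow> 'y))) set" where
  "pro_equiv Xs p Ys q = {((f, fs), (g, gs)).
      (f, fs) \<in> pro_reps Xs p Ys q \<and> (g, gs) \<in> pro_reps Xs p Ys q \<and>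
      (\<forall>n. \<exists>m. f n \<le> m \<and> g n \<le> m \<and>
         homotopic_with (\<lambda>_. True) (Xs m) (Ys n)
           (fs n \<circ> bonds p (f n) m) (gs n \<circ> bonds p (g n) m))}"

definition pro_morphisms where
  "pro_morphisms Xs p Ys q = pro_reps Xs p Ys q // pro_equiv Xs p Ys q"

definition hilbert_cube :: "(nat \<Rightarrow> real) topology" where
  "hilbert_cube = subtopology (powertop_real UNIV) {x. \<forall>i. 0 \<le> x i \<and> x i \<le> 1}"

definition hc_embedding :: "'a set \<Rightarrow> ('a \<Rightarrow> 'a \<Rightarrow> real) \<Rightarrow> 'a \<Rightarrow> (nat \<Rightarrow> real)" where
  "hc_embedding X d = (SOME e. embedding_map (Metric_space.mtopology X d) hilbert_cube e)"

definition hc_eventually_homotopic where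
  "hc_eventually_homotopic U V fs gs \<longleftrightarrow> (\<exists>k0. \<forall>k\<ge>k0.
      homotopic_with (\<lambda>_. True) (subtopology hilbert_cube U) (subtopology hilbert_cube V) (fs k) (gs k))"

definition fundamental_sequences ::
  "(nat \<Rightarrow> real) set \<Rightarrow> (nat \<Rightarrow> real) set \<Rightarrow> (nat \<Rightarrow> (nat \<Rightarrow> real) \<Rightarrow> (nat \<Rightarrow> real)) set" where
  "fundamental_sequences X' Y' = {fs. (\<forall>k. continuous_map hilbert_cube hilbert_cube (fs k)) \<and>
      (\<forall>V. openin hilbert_cube V \<and> Y' \<subseteq> V \<longrightarrow>
         (\<exists>U. openin hilbert_cube U \<and> X' \<subseteq> U \<and> hc_eventually_homotopic U V fs (\<lambda>k. fs (Suc k))))}"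

definition fs_homotopic where
  "fs_homotopic X' Y' = {(fs, gs). fs \<in> fundamental_sequences X' Y' \<and> gs \<in> fundamental_sequences X' Y' \<and>
      (\<forall>V. openin hilbert_cube V \<and> Y' \<subseteq> V \<longrightarrow>
         (\<exists>U. openin hilbert_cube U \<and> X' \<subseteq> U \<and> hc_eventually_homotopic U V fs gs))}"

definition shape_morphisms ::
  "'a set \<Rightarrow> ('a \<Rightarrow> 'a \<Rightarrow> real) \<Rightarrow> 'b set \<Rightarrow> ('b \<Rightarrow> 'b \<Rightarrow> real)
   \<Rightarrow> (nat \<Rightarrow> (nat \<Rightarrow> real) \<Rightarrow> (nat \<Rightarrow> real)) set set" where
  "shape_morphisms X d Y l =
     (let X' = hc_embedding X d ` X; Y' = hc_embedding Y l ` Y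
      in fundamental_sequences X' Y' // fs_homotopic X' Y')"

end

(*
  Both sets of morphisms are compared with a third one: sequences of arbitrary, not necessarily
  continuous functions v_k : X -> Y such that for every e > 0 almost all consecutive terms are
  joined by a finite chain of functions in which neighbours u, u' are e-contiguous, i.e.
  d(x, y) < delta implies that u x, u y, u' x, u' y are e-close; two sequences are identified if for
  every e almost all of their terms are joined by such chains.

  A representative (f_n, f) of a morphism in pro-HTop gives the sequence that picks a point
  v_n(x) of f_n({a : d(x, a) < eps_{f(n)}}). A homotopy between maps of finite spaces is locally
  comparable in the inclusion order, and comparable maps give contiguous functions. Conversely a
  function u induces the map C |-> {b : l(b, u c) < eta_n for some c in C}, contiguous functions
  induce homotopic maps, and the two constructions are inverse to each other up to homotopy.

  A fundamental sequence F_k of maps of the Hilbert cube gives the functions sending x in X to a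
  point of Y nearest to F_k(x). Conversely partitions of unity turn contiguous functions into
  continuous maps that are close on X, hence homotopic by a straight line; damping these
  homotopies off X makes them compatible on one fixed neighbourhood of X, as the definition of a
  fundamental sequence demands.
*)

theory Submission
  imports Defs
begin

section \<open>Discrete homotopy of non-continuous maps\<close>

text \<open>The functions in between may be discontinuous because neither a choice from a finite set
  nor a nearest point in Y is continuous. What survives both is a bound on the oscillation at some
  small scale, and this is all that \<open>contiguous\<close> records. The constants on the finite
  side form a budget. Composite bonding maps from level m to level n move points by at most 2 eps n
  - 2 eps m, because eps more than halves at each step; a set of diameter below 4 eps m thus goes to
  one of diameter below 4 eps m + 2 (2 eps n - 2 eps m) = 4 eps n. The factor 4 makes this budget
  close exactly, and most estimates on finite spaces are instances of it. On the cube side the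
  obstacle is the order of quantifiers: U is fixed before k, so homotopies whose domains shrink with
  k are useless. The equivalence properties of the two outer relations are inherited from the
  relation in between. The arbitrary choice of the embeddings does no harm, as discrete homotopy
  classes are invariant under bijections that are uniformly continuous in both directions.\<close>

lemma eqpoll_quotient:
  assumes T: "equiv B T" and R: "R \<subseteq> A \<times> A" and F: "\<And>a. a \<in> A \<Longrightarrow> F a \<in> B"
    and RT: "\<And>a a'. a \<in> A \<Longrightarrow> a' \<in> A \<Longrightarrow> (a, a') \<in> R \<longleftrightarrow> (F a, F a') \<in> T"
    and surj: "\<And>b. b \<in> B \<Longrightarrow> \<exists>a\<in>A. (F a, b) \<in> T"
  shows "A // R \<approx> B // T"
proof -
  have refl: "(F a, F a) \<in> T" if "a \<in> A" for a
    using T F that by (auto simp: equiv_def refl_on_def)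
  \<comment> \<open>The induced map sends the \<open>R\<close>-class of a to the
    \<open>T\<close>-class of \<open>F a\<close>; saturating the image under \<open>T\<close>
    removes the dependence on representatives.\<close>
  have cls: "T `` (F ` (R `` {a})) = T `` {F a}" if a: "a \<in> A" for a
  proof -
    have "T `` {F a'} = T `` {F a}" if "(a, a') \<in> R" for a'
      using that R RT[of a a'] a equiv_class_eq[OF T] by (metis mem_Sigma_iff subsetD)
    moreover have "(a, a) \<in> R" using RT a refl by blast
    moreover have "T `` (F ` (R `` {a})) = (\<Union>a'\<in>R `` {a}. T `` {F a'})" by blast
    ultimately show ?thesis by blast
  qed
  have "bij_betw (\<lambda>C. T `` (F ` C)) (A // R) (B // T)"
    unfolding bij_betw_def
  proof
    show "inj_on (\<lambda>C. T `` (F ` C)) (A // R)"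
    proof (rule inj_onI)
      fix C D assume "C \<in> A // R" "D \<in> A // R" and eq: "T `` (F ` C) = T `` (F ` D)"
      then obtain a b where a: "a \<in> A" "C = R `` {a}" and b: "b \<in> A" "D = R `` {b}"
        by (auto simp: quotient_def)
      have "T `` {F a} = T `` {F b}" using eq cls a b by simp
      then have ab: "(F a, F b) \<in> T" using eq_equiv_class[OF _ T] F b by simp
      have "(a, c) \<in> R \<longleftrightarrow> (b, c) \<in> R" for c
      proof (cases "c \<in> A")
        case True
        have "(F a, F c) \<in> T \<longleftrightarrow> (F b, F c) \<in> T"
          using equiv_class_eq[OF T ab] by blast
        then show ?thesis using RT a b True by simp
      qed (use R in auto)
      then show "C = D" using a b by auto
    qed
    show "(\<lambda>C. T `` (F ` C)) ` (A // R) = B // T"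
    proof
      show "(\<lambda>C. T `` (F ` C)) ` (A // R) \<subseteq> B // T"
        using cls F unfolding quotient_def by fastforce
      show "B // T \<subseteq> (\<lambda>C. T `` (F ` C)) ` (A // R)"
      proof
        fix D assume "D \<in> B // T"
        then obtain b where b: "b \<in> B" "D = T `` {b}" by (auto simp: quotient_def)
        obtain a where a: "a \<in> A" "(F a, b) \<in> T" using surj b by blast
        have "D = T `` (F ` (R `` {a}))" using cls a b equiv_class_eq[OF T] by metis
        then show "D \<in> (\<lambda>C. T `` (F ` C)) ` (A // R)" using a by (auto simp: quotient_def)
      qed
    qed
  qed
  then show ?thesis by (auto simp: eqpoll_def)
qed

section \<open>Contiguity, discrete homotopy and sequences up to discrete homotopy\<close>

locale metric_pair = dom: Metric_space X d + cod: Metric_space Y l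
  for X :: "'a set" and d and Y :: "'b set" and l
begin

text \<open>Each function is also compared with itself, so standing in the relation already bounds
  the oscillation of u and of v. The scale \<delta> may depend on the pair.\<close>

definition contiguous :: "real \<Rightarrow> ('a \<Rightarrow> 'b) \<Rightarrow> ('a \<Rightarrow> 'b) \<Rightarrow> bool" where
  "contiguous e u v \<longleftrightarrow> u \<in> X \<rightarrow> Y \<and> v \<in> X \<rightarrow> Y \<and>
     (\<exists>\<delta>>0. \<forall>x\<in>X. \<forall>y\<in>X. d x y < \<delta> \<longrightarrow> l (u x) (u y) < e \<and> l (v x) (v y) < e \<and> l (u x) (v y) < e)"

text \<open>The closure is deliberately not reflexive: \<open>discrete_homotopic e u u\<close> holds
  exactly when u maps X to Y and oscillates by less than e at some scale.\<close>

definition discrete_homotopic :: "real \<Rightarrow> ('a \<Rightarrow> 'b) \<Rightarrow> ('a \<Rightarrow> 'b) \<Rightarrow> bool" where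
  "discrete_homotopic e = (contiguous e)\<^sup>+\<^sup>+"

definition discrete_sequences :: "(nat \<Rightarrow> 'a \<Rightarrow> 'b) set" where
  "discrete_sequences = {v. \<forall>e>0. \<exists>N. \<forall>k\<ge>N. discrete_homotopic e (v k) (v (Suc k))}"

definition discrete_equiv :: "((nat \<Rightarrow> 'a \<Rightarrow> 'b) \<times> (nat \<Rightarrow> 'a \<Rightarrow> 'b)) set" where
  "discrete_equiv = {(v, w). v \<in> discrete_sequences \<and> w \<in> discrete_sequences \<and>
     (\<forall>e>0. \<exists>N. \<forall>k\<ge>N. discrete_homotopic e (v k) (w k))}"

lemma contiguousI:
  assumes "u \<in> X \<rightarrow> Y" "v \<in> X \<rightarrow> Y" "\<delta> > 0"
    and "\<And>x y. x \<in> X \<Longrightarrow> y \<in> X \<Longrightarrow> d x y < \<delta> \<Longrightarrow> l (u x) (u y) < e \<and> l (v x) (v y) < e \<and> l (u x) (v y) < e"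
  shows "contiguous e u v"
  using assms unfolding contiguous_def by blast

lemma contiguous_sym: "contiguous e u v \<Longrightarrow> contiguous e v u"
  unfolding contiguous_def by (metis cod.commute dom.commute)

lemma contiguous_mono: "contiguous e u v \<Longrightarrow> e \<le> e' \<Longrightarrow> contiguous e' u v"
  unfolding contiguous_def by (meson less_le_trans)

lemma contiguous_cong:
  assumes "contiguous e u v" "\<forall>x\<in>X. u' x = u x" "\<forall>x\<in>X. v' x = v x"
  shows "contiguous e u' v'"
proof -
  obtain \<delta> where "\<delta> > 0" "u \<in> X \<rightarrow> Y" "v \<in> X \<rightarrow> Y"
    and "\<forall>x\<in>X. \<forall>y\<in>X. d x y < \<delta> \<longrightarrow> l (u x) (u y) < e \<and> l (v x) (v y) < e \<and> l (u x) (v y) < e"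
    using assms(1) unfolding contiguous_def by blast
  then show ?thesis using assms(2,3) by (intro contiguousI[of u' v' \<delta>]) (auto simp: Pi_iff)
qed

lemma contiguous_imp_discrete_homotopic: "contiguous e u v \<Longrightarrow> discrete_homotopic e u v"
  by (simp add: discrete_homotopic_def)

lemma discrete_homotopic_trans [trans]:
  "discrete_homotopic e u v \<Longrightarrow> discrete_homotopic e v w \<Longrightarrow> discrete_homotopic e u w"
  by (simp add: discrete_homotopic_def)

lemma discrete_homotopic_sym:
  assumes "discrete_homotopic e u v"
  shows "discrete_homotopic e v u"
  using assms unfolding discrete_homotopic_def
proof induction
  case (base v)
  from contiguous_sym[OF this] show ?case by (rule tranclp.r_into_trancl[of "contiguous e"])
next
  case (step v w)
  from contiguous_sym[OF step(2)] step(3) show ?case by (rule tranclp_into_tranclp2[of "contiguous e"])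
qed

lemma discrete_homotopic_refl: "discrete_homotopic e u v \<Longrightarrow> discrete_homotopic e u u"
  by (rule discrete_homotopic_trans[OF _ discrete_homotopic_sym])

lemma discrete_homotopic_mono:
  assumes "discrete_homotopic e u v" "e \<le> e'"
  shows "discrete_homotopic e' u v"
  using assms(1) unfolding discrete_homotopic_def
proof induction
  case (base v)
  from contiguous_mono[OF this assms(2)] show ?case by (rule tranclp.r_into_trancl[of "contiguous e'"])
next
  case (step v w)
  from step(3) contiguous_mono[OF step(2) assms(2)] show ?case by (rule tranclp.trancl_into_trancl[of "contiguous e'"])
qed

text \<open>Functions are total while only their values on X count; changing an end of a chain off X
  affects just the adjacent link.\<close>

lemma discrete_homotopic_cong_left:
  assumes "discrete_homotopic e u v" "\<forall>x\<in>X. u' x = u x"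
  shows "discrete_homotopic e u' v"
proof -
  consider "contiguous e u v" | w where "contiguous e u w" "(contiguous e)\<^sup>+\<^sup>+ w v"
    using assms(1) unfolding discrete_homotopic_def by (rule converse_tranclpE)
  then show ?thesis
  proof cases
    case 1
    have "contiguous e u' v" by (rule contiguous_cong[OF 1 assms(2)]) auto
    then show ?thesis by (rule contiguous_imp_discrete_homotopic)
  next
    case (2 w)
    have "contiguous e u' w" by (rule contiguous_cong[OF 2(1) assms(2)]) auto
    then show ?thesis
      unfolding discrete_homotopic_def using 2(2) by (rule tranclp_into_tranclp2[of "contiguous e"])
  qed
qed

lemma discrete_homotopic_cong:
  assumes "discrete_homotopic e u v" "\<forall>x\<in>X. u' x = u x" "\<forall>x\<in>X. v' x = v x"
  shows "discrete_homotopic e u' v'"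
proof -
  have "discrete_homotopic e v u'"
    by (rule discrete_homotopic_sym, rule discrete_homotopic_cong_left[OF assms(1,2)])
  then show ?thesis by (rule discrete_homotopic_sym[OF discrete_homotopic_cong_left[OF _ assms(3)]])
qed

lemma discrete_homotopic_chain:
  assumes step: "\<And>k. N \<le> k \<Longrightarrow> discrete_homotopic e (v k) (v (Suc k))" and "N \<le> i" "N \<le> j"
  shows "discrete_homotopic e (v i) (v j)"
proof -
  have "discrete_homotopic e (v N) (v k)" if "N \<le> k" for k
    using that
  proof (induction rule: dec_induct)
    case base show ?case by (rule discrete_homotopic_refl[OF step]) simp
  next
    case (step n)
    then show ?case using assms(1)[of n] discrete_homotopic_trans[of e "v N" "v n"] by simp
  qed
  then show ?thesis
    using discrete_homotopic_trans[OF discrete_homotopic_sym] assms(2,3) by blast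
qed

lemma discrete_sequences_tail:
  assumes "v \<in> discrete_sequences" "e > 0"
  shows "\<exists>N. \<forall>i\<ge>N. \<forall>j\<ge>N. discrete_homotopic e (v i) (v j)"
proof -
  obtain N where "\<forall>k\<ge>N. discrete_homotopic e (v k) (v (Suc k))"
    using assms by (auto simp: discrete_sequences_def)
  then have "discrete_homotopic e (v i) (v j)" if "N \<le> i" "N \<le> j" for i j
    using discrete_homotopic_chain[of N e v i j] that by blast
  then show ?thesis by blast
qed

lemma equiv_discrete_equiv: "equiv discrete_sequences discrete_equiv"
proof (rule equivI)
  show "discrete_equiv \<subseteq> discrete_sequences \<times> discrete_sequences"
    by (auto simp: discrete_equiv_def)
  show "refl_on discrete_sequences discrete_equiv"
  proof (rule refl_onI)
    fix v assume "v \<in> discrete_sequences"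
    then show "(v, v) \<in> discrete_equiv"
      unfolding discrete_equiv_def using discrete_sequences_tail[of v] by simp blast
  qed
  show "sym discrete_equiv"
  proof (rule symI)
    fix v w assume vw: "(v, w) \<in> discrete_equiv"
    have "\<exists>N. \<forall>k\<ge>N. discrete_homotopic e (w k) (v k)" if "e > 0" for e
    proof -
      obtain N where "\<forall>k\<ge>N. discrete_homotopic e (v k) (w k)"
        using vw \<open>e > 0\<close> unfolding discrete_equiv_def by blast
      then have "discrete_homotopic e (w k) (v k)" if "N \<le> k" for k
        using discrete_homotopic_sym[of e "v k" "w k"] that by simp
      then show ?thesis by blast
    qed
    then show "(w, v) \<in> discrete_equiv" using vw by (simp add: discrete_equiv_def)
  qed
  show "trans discrete_equiv"
  proof (rule transI)
    fix u v w assume uv: "(u, v) \<in> discrete_equiv" and vw: "(v, w) \<in> discrete_equiv"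
    have "\<exists>N. \<forall>k\<ge>N. discrete_homotopic e (u k) (w k)" if "e > 0" for e
    proof -
      obtain N M where "\<forall>k\<ge>N. discrete_homotopic e (u k) (v k)" "\<forall>k\<ge>M. discrete_homotopic e (v k) (w k)"
        using uv vw \<open>e > 0\<close> unfolding discrete_equiv_def by blast
      then have "discrete_homotopic e (u k) (w k)" if "max N M \<le> k" for k
        using that by (intro discrete_homotopic_trans[of e "u k" "v k" "w k"]) auto
      then show ?thesis by blast
    qed
    then show "(u, w) \<in> discrete_equiv" using uv vw by (simp add: discrete_equiv_def)
  qed
qed

text \<open>The property of being a discrete sequence passes from v to u: late terms
  \<open>u k\<close> and \<open>u (Suc k)\<close> are joined through \<open>v k\<close> and
  \<open>v (Suc k)\<close>.\<close>

lemma discrete_equivI: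
  assumes v: "v \<in> discrete_sequences"
    and near: "\<And>e. e > 0 \<Longrightarrow> \<exists>N. \<forall>k\<ge>N. discrete_homotopic e (u k) (v k)"
  shows "(u, v) \<in> discrete_equiv"
proof -
  have "\<exists>N. \<forall>k\<ge>N. discrete_homotopic e (u k) (u (Suc k))" if e: "e > 0" for e
  proof -
    obtain N where N: "\<forall>k\<ge>N. discrete_homotopic e (u k) (v k)" using near e by blast
    obtain M where M: "\<forall>i\<ge>M. \<forall>j\<ge>M. discrete_homotopic e (v i) (v j)"
      using discrete_sequences_tail[OF v e] by blast
    have "discrete_homotopic e (u k) (u (Suc k))" if "max N M \<le> k" for k
    proof (rule discrete_homotopic_trans[OF discrete_homotopic_trans])
      show "discrete_homotopic e (u k) (v k)" using N that by simp
      show "discrete_homotopic e (v k) (v (Suc k))" using M that by simp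
      show "discrete_homotopic e (v (Suc k)) (u (Suc k))"
        by (rule discrete_homotopic_sym) (use N that in simp)
    qed
    then show ?thesis by blast
  qed
  then show ?thesis using near v by (simp add: discrete_equiv_def discrete_sequences_def)
qed

text \<open>A subsequence stays in the class of v and can be made to satisfy a prescribed bound at
  every step from n = 0 on, as the level-by-level constructions of representatives require.\<close>

lemma discrete_sequences_fast:
  assumes v: "v \<in> discrete_sequences" and \<eta>: "\<And>n. \<eta> n > 0"
  obtains u where "(u, v) \<in> discrete_equiv" "\<And>n. discrete_homotopic (\<eta> n) (u n) (u (Suc n))"
proof -
  have "\<exists>N. \<forall>i\<ge>N. \<forall>j\<ge>N. discrete_homotopic (\<eta> n) (v i) (v j)" for n
    by (rule discrete_sequences_tail[OF v \<eta>])
  then obtain N where N: "\<And>n i j. N n \<le> i \<Longrightarrow> N n \<le> j \<Longrightarrow> discrete_homotopic (\<eta> n) (v i) (v j)"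
    by metis
  \<comment> \<open>The sum dominates \<open>N n\<close> and grows with n; the summand n keeps the
    subsequence cofinal, hence equivalent to v.\<close>
  define s where "s n = n + (\<Sum>i\<le>n. N i)" for n
  have sN: "N n \<le> s n" "n \<le> s n" "s n \<le> s (Suc n)" for n
    by (auto simp: s_def intro: trans_le_add2 member_le_sum)
  show thesis
  proof
    show "discrete_homotopic (\<eta> n) (v (s n)) (v (s (Suc n)))" for n
      using sN[of n] by (intro N) auto
    show "(\<lambda>n. v (s n), v) \<in> discrete_equiv"
    proof (rule discrete_equivI[OF v])
      fix e :: real assume "e > 0"
      then obtain M where "\<forall>i\<ge>M. \<forall>j\<ge>M. discrete_homotopic e (v i) (v j)"
        using discrete_sequences_tail[OF v] by blast
      then show "\<exists>N. \<forall>k\<ge>N. discrete_homotopic e (v (s k)) (v k)"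
        using le_trans[OF _ sN(2)] by blast
    qed
  qed
qed

end

section \<open>Invariance under uniformly continuous changes of both spaces\<close>

locale metric_pair_change = metric_pair X d Y l + target: metric_pair X' d' Y' l'
  for X :: "'a set" and d and Y :: "'b set" and l
    and X' :: "'c set" and d' and Y' :: "'e set" and l' +
  fixes a :: "'c \<Rightarrow> 'a" and b :: "'b \<Rightarrow> 'e"
  assumes a: "a \<in> X' \<rightarrow> X" "\<And>e. e > 0 \<Longrightarrow> \<exists>\<delta>>0. \<forall>x\<in>X'. \<forall>y\<in>X'. d' x y < \<delta> \<longrightarrow> d (a x) (a y) < e"
    and b: "b \<in> Y \<rightarrow> Y'" "\<And>e. e > 0 \<Longrightarrow> \<exists>\<delta>>0. \<forall>x\<in>Y. \<forall>y\<in>Y. l x y < \<delta> \<longrightarrow> l' (b x) (b y) < e"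
begin

text \<open>The scales travel in opposite directions: uniform continuity of b turns e' into e, and
  that of a pulls the \<delta> of each link back to X'. Since e depends on e' alone, it serves every
  link of a chain.\<close>

lemma discrete_homotopic_transport:
  assumes "e' > 0"
  obtains e where "e > 0"
    "\<And>u v. discrete_homotopic e u v \<Longrightarrow> target.discrete_homotopic e' (b \<circ> u \<circ> a) (b \<circ> v \<circ> a)"
proof -
  obtain e where e: "e > 0" "\<forall>x\<in>Y. \<forall>y\<in>Y. l x y < e \<longrightarrow> l' (b x) (b y) < e'"
    using b(2) assms by blast
  have contig: "target.contiguous e' (b \<circ> u \<circ> a) (b \<circ> v \<circ> a)" if uv: "contiguous e u v" for u v
  proof -
    obtain \<delta> where \<delta>: "\<delta> > 0" "u \<in> X \<rightarrow> Y" "v \<in> X \<rightarrow> Y"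
      "\<forall>x\<in>X. \<forall>y\<in>X. d x y < \<delta> \<longrightarrow> l (u x) (u y) < e \<and> l (v x) (v y) < e \<and> l (u x) (v y) < e"
      using uv unfolding contiguous_def by blast
    obtain \<delta>' where "\<delta>' > 0" "\<forall>x\<in>X'. \<forall>y\<in>X'. d' x y < \<delta>' \<longrightarrow> d (a x) (a y) < \<delta>"
      using a(2) \<delta>(1) by blast
    then show ?thesis
      using \<delta> e a(1) b(1) by (intro target.contiguousI[of _ _ \<delta>']) (auto simp: Pi_iff)
  qed
  show thesis
  proof
    fix u v assume "discrete_homotopic e u v"
    then show "target.discrete_homotopic e' (b \<circ> u \<circ> a) (b \<circ> v \<circ> a)"
      unfolding discrete_homotopic_def
    proof induction
      case (base v)
      then show ?case by (rule target.contiguous_imp_discrete_homotopic[OF contig])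
    next
      case (step v w)
      from step(3) target.contiguous_imp_discrete_homotopic[OF contig[OF step(2)]] show ?case
        by (rule target.discrete_homotopic_trans)
    qed
  qed (rule e)
qed

lemma discrete_sequences_transport:
  assumes v: "v \<in> discrete_sequences"
  shows "(\<lambda>k. b \<circ> v k \<circ> a) \<in> target.discrete_sequences"
proof -
  have "\<exists>N. \<forall>k\<ge>N. target.discrete_homotopic e' (b \<circ> v k \<circ> a) (b \<circ> v (Suc k) \<circ> a)" if "e' > 0" for e'
  proof -
    from that obtain e where e: "e > 0"
      "\<And>u v. discrete_homotopic e u v \<Longrightarrow> target.discrete_homotopic e' (b \<circ> u \<circ> a) (b \<circ> v \<circ> a)"
      using discrete_homotopic_transport by blast
    then show ?thesis using v unfolding discrete_sequences_def by blast
  qed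
  then show ?thesis by (simp add: target.discrete_sequences_def)
qed

lemma discrete_equiv_transport:
  assumes vw: "(v, w) \<in> discrete_equiv"
  shows "(\<lambda>k. b \<circ> v k \<circ> a, \<lambda>k. b \<circ> w k \<circ> a) \<in> target.discrete_equiv"
proof (rule target.discrete_equivI)
  show "(\<lambda>k. b \<circ> w k \<circ> a) \<in> target.discrete_sequences"
    using discrete_sequences_transport vw by (simp add: discrete_equiv_def)
  fix e' :: real assume "e' > 0"
  then obtain e where e: "e > 0"
    "\<And>u v. discrete_homotopic e u v \<Longrightarrow> target.discrete_homotopic e' (b \<circ> u \<circ> a) (b \<circ> v \<circ> a)"
    using discrete_homotopic_transport by blast
  then show "\<exists>N. \<forall>k\<ge>N. target.discrete_homotopic e' (b \<circ> v k \<circ> a) (b \<circ> w k \<circ> a)"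
    using vw unfolding discrete_equiv_def by blast
qed

end

text \<open>Discrete homotopy classes see only the uniform structures. This links the classes for
  the given metrics to those for the images in the Hilbert cube.\<close>

proposition eqpoll_discrete_change_metric:
  assumes "metric_pair_change X d Y l X' d' Y' l' a b"
    and "metric_pair_change X' d' Y' l' X d Y l a' b'"
    and aa: "\<And>x. x \<in> X \<Longrightarrow> a (a' x) = x" "\<And>x. x \<in> X' \<Longrightarrow> a' (a x) = x"
    and bb: "\<And>y. y \<in> Y \<Longrightarrow> b' (b y) = y" "\<And>y. y \<in> Y' \<Longrightarrow> b (b' y) = y"
  shows "metric_pair.discrete_sequences X d Y l // metric_pair.discrete_equiv X d Y l \<approx>
         metric_pair.discrete_sequences X' d' Y' l' // metric_pair.discrete_equiv X' d' Y' l'"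
proof -
  interpret to: metric_pair_change X d Y l X' d' Y' l' a b by fact
  interpret fro: metric_pair_change X' d' Y' l' X d Y l a' b' by fact
  let ?F = "\<lambda>v k. b \<circ> v k \<circ> a" and ?G = "\<lambda>v k. b' \<circ> v k \<circ> a'"
  show ?thesis
  proof (rule eqpoll_quotient[of _ _ _ _ ?F])
    show "equiv to.target.discrete_sequences to.target.discrete_equiv"
      by (rule to.target.equiv_discrete_equiv)
    show "to.discrete_equiv \<subseteq> to.discrete_sequences \<times> to.discrete_sequences"
      by (auto simp: to.discrete_equiv_def)
    show "?F v \<in> to.target.discrete_sequences" if "v \<in> to.discrete_sequences" for v
      using that by (rule to.discrete_sequences_transport)
    show "(v, w) \<in> to.discrete_equiv \<longleftrightarrow> (?F v, ?F w) \<in> to.target.discrete_equiv"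
      if v: "v \<in> to.discrete_sequences" and w: "w \<in> to.discrete_sequences" for v w
    proof
      show "(?F v, ?F w) \<in> to.target.discrete_equiv" if "(v, w) \<in> to.discrete_equiv"
        using that by (rule to.discrete_equiv_transport)
      assume "(?F v, ?F w) \<in> to.target.discrete_equiv"
      from fro.discrete_equiv_transport[OF this]
      have eq: "(?G (?F v), ?G (?F w)) \<in> to.discrete_equiv" by simp
      \<comment> \<open>\<open>G (F v)\<close> agrees with \<open>v\<close> at those \<open>k\<close> for which \<open>v k\<close> maps \<open>X\<close> into \<open>Y\<close>, hence eventually.\<close>
      have agree: "\<exists>N. \<forall>k\<ge>N. \<forall>x\<in>X. u k x = ?G (?F u) k x" if u: "u \<in> to.discrete_sequences" for u
      proof -
        obtain N where N: "\<forall>k\<ge>N. to.discrete_homotopic 1 (u k) (u (Suc k))"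
          using u unfolding to.discrete_sequences_def by fastforce
        have "u k \<in> X \<rightarrow> Y" if "N \<le> k" for k
          using N that unfolding to.discrete_homotopic_def
          by (metis converse_tranclpE to.contiguous_def)
        then show ?thesis using aa(1) bb(1) by (intro exI[of _ N]) (simp add: Pi_iff)
      qed
      obtain N where N: "\<forall>k\<ge>N. \<forall>x\<in>X. v k x = ?G (?F v) k x \<and> w k x = ?G (?F w) k x"
        using agree[OF v] agree[OF w] by (metis max.bounded_iff)
      have "\<exists>M. \<forall>k\<ge>M. to.discrete_homotopic e (v k) (w k)" if "e > 0" for e
      proof -
        obtain M where M: "\<forall>k\<ge>M. to.discrete_homotopic e (?G (?F v) k) (?G (?F w) k)"
          using eq \<open>e > 0\<close> unfolding to.discrete_equiv_def by blast
        have "to.discrete_homotopic e (v k) (w k)" if "max M N \<le> k" for k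
          by (rule to.discrete_homotopic_cong[of e "?G (?F v) k" "?G (?F w) k"])
            (use M N that in auto)
        then show ?thesis by blast
      qed
      then show "(v, w) \<in> to.discrete_equiv" using v w by (simp add: to.discrete_equiv_def)
    qed
    show "\<exists>v\<in>to.discrete_sequences. (?F v, w) \<in> to.target.discrete_equiv"
      if w: "w \<in> to.target.discrete_sequences" for w
    proof
      show G: "?G w \<in> to.discrete_sequences" using w by (rule fro.discrete_sequences_transport)
      show "(?F (?G w), w) \<in> to.target.discrete_equiv"
      proof (rule to.target.discrete_equivI[OF w])
        fix e :: real assume e: "e > 0"
        obtain N where N: "\<forall>k\<ge>N. to.target.discrete_homotopic e (w k) (w (Suc k))"
          using w e unfolding to.target.discrete_sequences_def by fastforce
        have "to.target.discrete_homotopic e (?F (?G w) k) (w k)" if k: "N \<le> k" for k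
        proof -
          have hom: "to.target.discrete_homotopic e (w k) (w k)"
            using N k to.target.discrete_homotopic_refl by blast
          then have "w k \<in> X' \<rightarrow> Y'" unfolding to.target.discrete_homotopic_def
            by (metis converse_tranclpE to.target.contiguous_def)
          then show ?thesis
            by (intro to.target.discrete_homotopic_cong[OF hom]) (use aa bb in \<open>auto simp: Pi_iff\<close>)
        qed
        then show "\<exists>N. \<forall>k\<ge>N. to.target.discrete_homotopic e (?F (?G w) k) (w k)" by blast
      qed
    qed
  qed
qed

section \<open>Finite spaces of small subsets\<close>

lemma openin_downset_topology:
  "openin (downset_topology P) S \<longleftrightarrow> S \<subseteq> P \<and> (\<forall>C\<in>S. \<forall>D\<in>P. D \<subseteq> C \<longrightarrow> D \<in> S)"
proof -
  have "istopology (\<lambda>S. S \<subseteq> P \<and> (\<forall>C\<in>S. \<forall>D\<in>P. D \<subseteq> C \<longrightarrow> D \<in> S))"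
    unfolding istopology_def by blast
  then show ?thesis by (simp add: downset_topology_def topology_inverse')
qed

lemma topspace_downset_topology [simp]: "topspace (downset_topology P) = P"
  unfolding topspace_def openin_downset_topology by blast

lemma continuous_map_downset_topology:
  "continuous_map (downset_topology P) (downset_topology Q) f \<longleftrightarrow>
     f \<in> P \<rightarrow> Q \<and> (\<forall>C\<in>P. \<forall>D\<in>P. D \<subseteq> C \<longrightarrow> f D \<subseteq> f C)" (is "?L \<longleftrightarrow> ?R")
proof
  assume L: ?L
  then have PQ: "f \<in> P \<rightarrow> Q" using continuous_map_funspace by fastforce
  have "f D \<subseteq> f C" if "C \<in> P" "D \<in> P" "D \<subseteq> C" for C D
  proof -
    \<comment> \<open>The principal down-set of \<open>f C\<close> is the least open set containing
      it; its preimage is a down-set through C and so contains D.\<close>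
    have "openin (downset_topology Q) {E \<in> Q. E \<subseteq> f C}" by (auto simp: openin_downset_topology)
    then have "openin (downset_topology P) {x \<in> P. f x \<in> {E \<in> Q. E \<subseteq> f C}}"
      using L unfolding continuous_map_def topspace_downset_topology by blast
    then show ?thesis using that PQ unfolding openin_downset_topology by blast
  qed
  with PQ show ?R by blast
next
  assume ?R
  then show ?L unfolding continuous_map_def openin_downset_topology topspace_downset_topology
    by (auto simp: Pi_iff)
qed

text \<open>The homotopy rests at f for t < 1 and jumps to g at t = 1. This is continuous because
  open sets are down-sets: if \<open>g C\<close> lies in S, so does the smaller \<open>f C\<close>,
  and the preimage of S becomes a union of two open products.\<close>

lemma homotopic_downset_topology_le:
  assumes f: "continuous_map (downset_topology P) (downset_topology Q) f"
    and g: "continuous_map (downset_topology P) (downset_topology Q) g"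
    and le: "\<And>C. C \<in> P \<Longrightarrow> f C \<subseteq> g C"
  shows "homotopic_with (\<lambda>_. True) (downset_topology P) (downset_topology Q) f g"
proof -
  let ?h = "\<lambda>(t::real, C). if t = 1 then g C else f C"
  let ?I = "top_of_set {0..1::real}"
  have "continuous_map (prod_topology ?I (downset_topology P)) (downset_topology Q) ?h"
    unfolding continuous_map_def
  proof (intro conjI allI impI)
    show "?h \<in> topspace (prod_topology ?I (downset_topology P)) \<rightarrow> topspace (downset_topology Q)"
      using f g by (auto simp: continuous_map_downset_topology)
    fix S assume S: "openin (downset_topology Q) S"
    have fS: "openin (downset_topology P) {C \<in> P. f C \<in> S}" and gS: "openin (downset_topology P) {C \<in> P. g C \<in> S}"
      using f g S by (auto simp: continuous_map_def)
    have sub: "f C \<in> S" if "C \<in> P" "g C \<in> S" for C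
      using S le[of C] that f by (auto simp: openin_downset_topology continuous_map_downset_topology Pi_iff)
    have "openin ?I {0..<1}"
      by (metis Int_atLeastAtMostL1 atLeastLessThan_eq_atLeastAtMost_diff inf_commute openin_open
          ex_in_conv openin_delete openin_subtopology_self)
    then have "openin (prod_topology ?I (downset_topology P))
        ({0..<1} \<times> {C \<in> P. f C \<in> S} \<union> {0..1} \<times> {C \<in> P. g C \<in> S})"
      using fS gS by (intro openin_Un) (auto simp: openin_prod_Times_iff)
    moreover have "{0..<1} \<times> {C \<in> P. f C \<in> S} \<union> {0..1} \<times> {C \<in> P. g C \<in> S}
        = {x \<in> topspace (prod_topology ?I (downset_topology P)). ?h x \<in> S}"
      using sub by (auto split: if_splits)
    ultimately show "openin (prod_topology ?I (downset_topology P))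
        {x \<in> topspace (prod_topology ?I (downset_topology P)). ?h x \<in> S}" by simp
  qed
  then show ?thesis unfolding homotopic_with_def by (intro exI[of _ ?h]) auto
qed

text \<open>The principal down-set of \<open>h (t, C)\<close> is open, so each path can only go down
  near t; finiteness of P yields one neighbourhood of t for all C. This is how a homotopy breaks up
  into comparable maps.\<close>

lemma homotopy_downset_topology_local:
  assumes h: "continuous_map (prod_topology (top_of_set {0..1::real}) (downset_topology P)) (downset_topology Q) h"
    and P: "finite P" and t: "t \<in> {0..1}"
  obtains T where "openin (top_of_set {0..1}) T" "t \<in> T" "\<forall>s\<in>T. \<forall>C\<in>P. h (s, C) \<subseteq> h (t, C)"
proof -
  have "\<exists>T. openin (top_of_set {0..1}) T \<and> t \<in> T \<and> (\<forall>s\<in>T. h (s, C) \<subseteq> h (t, C))" if C: "C \<in> P" for C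
  proof -
    have "continuous_map (top_of_set {0..1}) (downset_topology Q) (\<lambda>s. h (s, C))"
      using continuous_map_compose[OF _ h, of "top_of_set {0..1}" "\<lambda>s. (s, C)"] C
      by (simp add: o_def continuous_map_pairwise)
    moreover have "openin (downset_topology Q) {E \<in> Q. E \<subseteq> h (t, C)}"
      by (auto simp: openin_downset_topology)
    ultimately have "openin (top_of_set {0..1}) {s \<in> {0..1}. h (s, C) \<in> {E \<in> Q. E \<subseteq> h (t, C)}}"
      by (auto simp: continuous_map_def)
    moreover have "h (t, C) \<in> Q" using h C t by (force simp: continuous_map_def)
    ultimately show ?thesis using t by (intro exI conjI) auto
  qed
  then obtain T where T: "\<And>C. C \<in> P \<Longrightarrow> openin (top_of_set {0..1}) (T C) \<and> t \<in> T C \<and> (\<forall>s\<in>T C. h (s, C) \<subseteq> h (t, C))"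
    by metis
  show thesis
  proof (cases "P = {}")
    case True
    then show ?thesis using that[of "{0..1}"] t openin_subtopology_self by auto
  next
    case False
    show ?thesis
    proof (rule that[of "\<Inter>C\<in>P. T C"])
      show "openin (top_of_set {0..1}) (\<Inter>C\<in>P. T C)" using T P False by (intro openin_INT2) auto
    qed (use T in auto)
  qed
qed

section \<open>Composite bonding maps of an inverse sequence\<close>

lemma bond_add: "bond p n (j + k) = bond p n j \<circ> bond p (n + j) k"
  by (induction k) (simp_all add: add.assoc o_assoc)

lemma bonds_comp: "n \<le> m \<Longrightarrow> m \<le> k \<Longrightarrow> bonds p n m \<circ> bonds p m k = bonds p n k"
  using bond_add[of p n "m - n" "k - m"] by (simp add: bonds_def)

lemma bonds_refl [simp]: "bonds p n n = id"
  by (simp add: bonds_def)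

lemma bonds_Suc: "n \<le> m \<Longrightarrow> bonds p n (Suc m) = bonds p n m \<circ> p m"
  by (simp add: bonds_def Suc_diff_le)

lemma continuous_map_bonds:
  assumes "\<And>n. continuous_map (Xs (Suc n)) (Xs n) (p n)" and "n \<le> m"
  shows "continuous_map (Xs m) (Xs n) (bonds p n m)"
  using assms(2)
proof (induction m rule: dec_induct)
  case (step m)
  from continuous_map_compose[OF assms(1) step(3)] show ?case
    unfolding bonds_Suc[OF step(1)] .
qed simp

text \<open>The one-step squares are pasted: the square at N is composed with the bonds of the
  target on the left, the square obtained so far with the bonds of the source on the right.\<close>

lemma pro_reps_iterate:
  assumes rep: "(f, fs) \<in> pro_reps Xs p Ys q"
    and p: "\<And>n. continuous_map (Xs (Suc n)) (Xs n) (p n)"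
    and q: "\<And>n. continuous_map (Ys (Suc n)) (Ys n) (q n)" and "n \<le> N"
  shows "homotopic_with (\<lambda>_. True) (Xs (f N)) (Ys n) (bonds q n N \<circ> fs N) (fs n \<circ> bonds p (f n) (f N))"
  using \<open>n \<le> N\<close>
proof (induction N rule: dec_induct)
  case base
  then show ?case using rep by (auto simp: pro_reps_def)
next
  case (step N)
  have f: "f n \<le> f N" "f N \<le> f (Suc N)" using rep step by (auto simp: pro_reps_def monoD)
  have "homotopic_with (\<lambda>_. True) (Xs (f (Suc N))) (Ys n)
      (bonds q n N \<circ> (q N \<circ> fs (Suc N))) (bonds q n N \<circ> (fs N \<circ> bonds p (f N) (f (Suc N))))"
    using rep continuous_map_bonds[of Ys q, OF q] step
    by (intro homotopic_with_compose_continuous_map_left[where ?X2.0 = "Ys N"]) (auto simp: pro_reps_def)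
  moreover have "homotopic_with (\<lambda>_. True) (Xs (f (Suc N))) (Ys n)
      ((bonds q n N \<circ> fs N) \<circ> bonds p (f N) (f (Suc N)))
      ((fs n \<circ> bonds p (f n) (f N)) \<circ> bonds p (f N) (f (Suc N)))"
    by (rule homotopic_with_compose_continuous_map_right[OF step(3) continuous_map_bonds[of Xs p, OF p f(2)]]) simp
  ultimately have "homotopic_with (\<lambda>_. True) (Xs (f (Suc N))) (Ys n)
      (bonds q n N \<circ> (q N \<circ> fs (Suc N))) ((fs n \<circ> bonds p (f n) (f N)) \<circ> bonds p (f N) (f (Suc N)))"
    by (auto simp: o_assoc intro: homotopic_with_trans)
  then show ?case by (simp only: bonds_Suc[OF step(1), of q] comp_assoc bonds_comp[OF f, of p])
qed

text \<open>For finite nonempty C the supremum is attained, so a strict bound on all pairs gives a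
  strict bound on the diameter.\<close>

lemma set_diam_less_iff:
  assumes "finite C" "C \<noteq> {}"
  shows "set_diam d C < r \<longleftrightarrow> (\<forall>a\<in>C. \<forall>b\<in>C. d a b < r)"
  unfolding set_diam_def using assms by (subst finite_Sup_less_iff) auto

lemma U_r_iff:
  assumes "finite A"
  shows "C \<in> U_r d r A \<longleftrightarrow> C \<subseteq> A \<and> C \<noteq> {} \<and> (\<forall>a\<in>C. \<forall>b\<in>C. d a b < r)"
  unfolding U_r_def using set_diam_less_iff[of C d r] finite_subset[OF _ assms, of C] by auto

section \<open>Distance estimates in a finite approximation\<close>

locale approximated_space = Metric_space M d for M :: "'a set" and d +
  fixes eps :: "nat \<Rightarrow> real" and A :: "nat \<Rightarrow> 'a set"
  assumes approx: "finite_approximation M d eps A"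
begin

abbreviation "U n \<equiv> U_r d (4 * eps n) (A n)"
abbreviation "stage n \<equiv> fa_spaces d eps A n"
abbreviation "bonding \<equiv> fa_bonds d eps A"

text \<open>This is the natural projection of the space to the n-th stage; the bonding map is its
  union over the points of a set.\<close>

definition near :: "nat \<Rightarrow> 'a \<Rightarrow> 'a set" where
  "near n x = {a \<in> A n. d x a < eps n}"

lemma eps_pos: "eps n > 0" and eps_Suc: "eps (Suc n) < eps n / 2"
  and finite_A: "finite (A n)" and A_subset: "A n \<subseteq> M"
  using approx by (auto simp: finite_approximation_def eps_approximation_def)

lemma eps_half: "n < m \<Longrightarrow> 2 * eps m < eps n"
proof (induction rule: strict_inc_induct)
  case (base i)
  then show ?case using eps_Suc[of i] by simp
next
  case (step i)
  then show ?case using eps_Suc[of i] eps_pos[of "Suc i"] by simp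
qed

lemma eps_antimono: "n \<le> m \<Longrightarrow> eps m \<le> eps n"
  using eps_half[of n m] eps_pos[of m] by (cases "n = m") auto

lemma eps_small:
  assumes "e > 0"
  shows "\<exists>N. \<forall>n\<ge>N. eps n < e"
proof -
  have bound: "eps n \<le> eps 0 * (1/2) ^ n" for n
  proof (induction n)
    case (Suc n)
    then show ?case using eps_Suc[of n] by simp
  qed simp
  have "(\<lambda>n. eps 0 * (1/2) ^ n) \<longlonglongrightarrow> eps 0 * 0"
    by (intro tendsto_intros LIMSEQ_power_zero) simp
  then obtain N where "\<forall>n\<ge>N. eps 0 * (1/2) ^ n < e"
    using assms order_tendstoD(2)[of _ 0 sequentially e] by (auto simp: eventually_sequentially)
  then show ?thesis using bound by (meson le_less_trans)
qed

lemma U_iff: "C \<in> U n \<longleftrightarrow> C \<subseteq> A n \<and> C \<noteq> {} \<and> (\<forall>a\<in>C. \<forall>b\<in>C. d a b < 4 * eps n)"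
  by (rule U_r_iff[OF finite_A])

lemma U_subset: "C \<in> U n \<Longrightarrow> C \<subseteq> M"
  unfolding U_iff using A_subset by blast

lemma finite_U: "finite (U n)"
  by (rule finite_subset[of _ "Pow (A n)"]) (auto simp: U_iff finite_A)

lemma topspace_stage [simp]: "topspace (stage n) = U n"
  by (simp add: fa_spaces_def)

lemma near_subset: "near n x \<subseteq> A n" "near n x \<subseteq> M"
  using A_subset by (auto simp: near_def)

lemma in_M_if_near: "a \<in> near n x \<Longrightarrow> a \<in> M"
  using near_subset by blast

lemma near_nonempty: "x \<in> M \<Longrightarrow> near n x \<noteq> {}"
  using approx by (fastforce simp: near_def finite_approximation_def eps_approximation_def)

lemma near_dist: "a \<in> near n x \<Longrightarrow> d a x < eps n"
  by (simp add: near_def commute)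

lemma bonding_eq: "bonding n C = (\<Union>c\<in>C. near n c)"
  by (simp add: fa_bonds_def near_def)

lemma thicken_dist:
  assumes "a \<in> M" "b \<in> M" "c \<in> M" "c' \<in> M" "d a c \<le> r" "d b c' \<le> r" "d c c' < s"
  shows "d a b < s + 2 * r"
  using triangle[of a c b] triangle[of c c' b] commute[of b c'] assms by linarith

text \<open>All nontrivial memberships in \<open>U n\<close> are obtained from this estimate: moving
  both ends by at most r costs \<open>2 * r\<close>, which is deducted from the admissible diameter
  of C.\<close>

lemma thicken_in_U:
  assumes W: "W \<subseteq> A n" "W \<noteq> {}" "\<forall>w\<in>W. \<exists>c\<in>C. d w c \<le> r"
    and C: "C \<subseteq> M" "\<forall>c\<in>C. \<forall>c'\<in>C. d c c' < 4 * eps n - 2 * r"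
  shows "W \<in> U n"
proof -
  have "d a b < 4 * eps n" if ab: "a \<in> W" "b \<in> W" for a b
  proof -
    obtain c c' where c: "c \<in> C" "d a c \<le> r" "c' \<in> C" "d b c' \<le> r" using W(3) ab by meson
    then have "a \<in> M" "b \<in> M" "c \<in> M" "c' \<in> M" "d c c' < 4 * eps n - 2 * r"
      using C W(1) ab A_subset[of n] by auto
    then show ?thesis
      using thicken_dist[of a b c c' r "4 * eps n - 2 * r"] c by simp
  qed
  then show ?thesis using W by (simp add: U_iff)
qed

lemma near_in_U:
  assumes "x \<in> M"
  shows "near n x \<in> U n"
proof (rule thicken_in_U[where C = "{x}" and r = "eps n"])
  show "\<forall>w\<in>near n x. \<exists>c\<in>{x}. d w c \<le> eps n" using near_dist[of _ n x] by fastforce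
qed (use assms near_subset near_nonempty eps_pos[of n] in auto)

lemma continuous_map_bonding: "continuous_map (stage (Suc n)) (stage n) (bonding n)"
  unfolding fa_spaces_def continuous_map_downset_topology
proof (intro conjI ballI impI funcsetI)
  fix C assume C: "C \<in> U (Suc n)"
  then have CM: "C \<subseteq> M" "C \<noteq> {}" and dC: "\<forall>a\<in>C. \<forall>b\<in>C. d a b < 4 * eps (Suc n)"
    using U_subset by (auto simp: U_iff)
  show "bonding n C \<in> U n"
  proof (rule thicken_in_U[where C = C and r = "eps n"])
    show "\<forall>w\<in>bonding n C. \<exists>c\<in>C. d w c \<le> eps n"
      using near_dist[of _ n] unfolding bonding_eq by (meson UN_E less_imp_le)
    \<comment> \<open>Here halving enters: \<open>4 * eps (Suc n) < 2 * eps n\<close>, and the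
      remaining \<open>2 * eps n\<close> pays for one \<open>eps n\<close> at each end.\<close>
    show "\<forall>c\<in>C. \<forall>c'\<in>C. d c c' < 4 * eps n - 2 * eps n"
      using dC eps_Suc[of n] by fastforce
    show "bonding n C \<noteq> {}" using CM near_nonempty by (fastforce simp: bonding_eq)
  qed (use CM near_subset in \<open>auto simp: bonding_eq\<close>)
qed (auto simp: bonding_eq)

lemma continuous_map_stage_bonds: "n \<le> m \<Longrightarrow> continuous_map (stage m) (stage n) (bonds bonding n m)"
  by (rule continuous_map_bonds[of stage bonding, OF continuous_map_bonding])

lemma bonds_in_U: "C \<in> U m \<Longrightarrow> n \<le> m \<Longrightarrow> bonds bonding n m C \<in> U n"
  using continuous_map_funspace[OF continuous_map_stage_bonds] by fastforce

lemma bonds_subset: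
  assumes "n \<le> m" "C \<subseteq> M"
  shows "bonds bonding n m C \<subseteq> M"
  using assms
proof (induction m arbitrary: C rule: dec_induct)
  case (step m)
  have "bonding m C \<subseteq> M" using in_M_if_near by (auto simp: bonding_eq)
  then show ?case using step.IH by (simp add: bonds_Suc[OF step.hyps(1)])
qed simp

text \<open>The bound telescopes: the step at m moves a point by less than \<open>eps m\<close>,
  which is at most \<open>2 * eps m - 2 * eps (Suc m)\<close>. The subtracted term is kept because
  it exactly absorbs the diameter \<open>4 * eps m\<close> of a set in \<open>U m\<close>.\<close>

lemma bonds_dist:
  assumes "n \<le> m" "C \<subseteq> M" "a \<in> bonds bonding n m C"
  shows "\<exists>c\<in>C. d a c \<le> 2 * eps n - 2 * eps m"
  using assms
proof (induction m arbitrary: C rule: dec_induct)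
  case base
  then have "a \<in> C" "d a a = 0" by auto
  then show ?case by force
next
  case (step m)
  have M: "bonding m C \<subseteq> M" using in_M_if_near by (auto simp: bonding_eq)
  have a: "a \<in> bonds bonding n m (bonding m C)"
    using step.prems(2) bonds_Suc[OF step.hyps(1), of bonding] by simp
  then obtain b where b: "b \<in> bonding m C" "d a b \<le> 2 * eps n - 2 * eps m"
    using step.IH[OF M] by blast
  then obtain c where c: "c \<in> C" "b \<in> near m c" by (auto simp: bonding_eq)
  have "d a c \<le> d a b + d b c"
    using a b(1) c(1) M step.prems(1) bonds_subset[OF step.hyps(1) M] by (intro triangle) auto
  then show ?case using b(2) c near_dist[of b m c] eps_Suc[of m] by (intro bexI[of _ c]) auto
qed

end

section \<open>Morphisms of finite approximations as discrete homotopy classes\<close>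

locale approximated_pair = metric_pair X d Y l
    + dom: approximated_space X d eps A + cod: approximated_space Y l eta B
  for X :: "'a set" and d and Y :: "'b set" and l and eps A eta B
begin

section \<open>From maps of stages to functions by selection\<close>

definition select :: "nat \<Rightarrow> ('a set \<Rightarrow> 'b set) \<Rightarrow> 'a \<Rightarrow> 'b" where
  "select i h x = (SOME y. y \<in> h (dom.near i x))"

definition discretize :: "nat \<Rightarrow> ('a \<Rightarrow> 'b) \<Rightarrow> 'a set \<Rightarrow> 'b set" where
  "discretize n u C = (\<Union>c\<in>C. cod.near n (u c))"

lemma stage_map:
  assumes "continuous_map (dom.stage i) (cod.stage n) h"
  shows "C \<in> dom.U i \<Longrightarrow> h C \<in> cod.U n" "C \<in> dom.U i \<Longrightarrow> D \<in> dom.U i \<Longrightarrow> D \<subseteq> C \<Longrightarrow> h D \<subseteq> h C"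
  using assms by (auto simp: fa_spaces_def continuous_map_downset_topology)

lemma stage_map_funcset:
  assumes "continuous_map (dom.stage i) (cod.stage n) h"
  shows "h \<in> dom.U i \<rightarrow> cod.U n"
  using continuous_map_funspace[OF assms] by simp

lemma select_in:
  assumes "h \<in> dom.U i \<rightarrow> cod.U n" "x \<in> X"
  shows "select i h x \<in> h (dom.near i x)" "select i h x \<in> Y"
proof -
  have h: "h (dom.near i x) \<in> cod.U n" using assms dom.near_in_U by blast
  then show *: "select i h x \<in> h (dom.near i x)"
    unfolding select_def by (intro some_in_eq[THEN iffD2]) (simp add: cod.U_iff)
  then show "select i h x \<in> Y" using cod.U_subset[OF h] by blast
qed

text \<open>P x and Q x are the sets at which the values of u and v were selected. If the union of
  two such sets is again in \<open>dom.U i\<close>, its image under h contains both values by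
  monotonicity and has diameter below \<open>4 * eta n\<close>.\<close>

lemma contiguous_selections:
  assumes h: "continuous_map (dom.stage i) (cod.stage n) h" and "\<delta> > 0"
    and u: "\<And>x. x \<in> X \<Longrightarrow> u x \<in> h (P x) \<and> P x \<in> dom.U i"
    and v: "\<And>x. x \<in> X \<Longrightarrow> v x \<in> h (Q x) \<and> Q x \<in> dom.U i"
    and PQ: "\<And>x y. x \<in> X \<Longrightarrow> y \<in> X \<Longrightarrow> d x y < \<delta> \<Longrightarrow>
        P x \<union> P y \<in> dom.U i \<and> Q x \<union> Q y \<in> dom.U i \<and> P x \<union> Q y \<in> dom.U i"
  shows "contiguous (4 * eta n) u v"
proof -
  have close: "l a b < 4 * eta n"
    if "a \<in> h C" "b \<in> h D" "C \<in> dom.U i" "D \<in> dom.U i" "C \<union> D \<in> dom.U i" for a b C D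
  proof -
    have "h C \<subseteq> h (C \<union> D)" "h D \<subseteq> h (C \<union> D)" using stage_map(2)[OF h] that by auto
    then show ?thesis using stage_map(1)[OF h that(5)] that(1,2) unfolding cod.U_iff by blast
  qed
  have in_Y: "a \<in> Y" if "a \<in> h C" "C \<in> dom.U i" for a C
    using stage_map(1)[OF h that(2)] that(1) cod.U_subset by blast
  show ?thesis
  proof (rule contiguousI)
    show "u \<in> X \<rightarrow> Y" "v \<in> X \<rightarrow> Y" using u v in_Y by blast+
    fix x y assume "x \<in> X" "y \<in> X" "d x y < \<delta>"
    then show "l (u x) (u y) < 4 * eta n \<and> l (v x) (v y) < 4 * eta n \<and> l (u x) (v y) < 4 * eta n"
      using u v PQ[of x y] close by blast
  qed (rule \<open>\<delta> > 0\<close>)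
qed

text \<open>The bound \<open>2 * eps i\<close> is what \<open>4 * eps i\<close> leaves after each
  end has spent \<open>eps i\<close>.\<close>

lemma near_Un_near_in_U:
  assumes "x \<in> X" "y \<in> X" "d x y < 2 * eps i"
  shows "dom.near i x \<union> dom.near i y \<in> dom.U i"
proof (rule dom.thicken_in_U[where C = "{x, y}" and r = "eps i"])
  show "\<forall>w\<in>dom.near i x \<union> dom.near i y. \<exists>c\<in>{x, y}. d w c \<le> eps i"
    using dom.near_dist[of _ i] less_imp_le by blast
qed (use assms dom.near_subset[of i] dom.near_nonempty[of x] dom.eps_pos[of i] in \<open>auto simp: dom.commute\<close>)

text \<open>For s near t the values of \<open>h (s, _)\<close> are contained in those of
  \<open>h (t, _)\<close>, so both selections are selections from the one map at time t and hence
  contiguous. Connectedness of the unit interval joins the two ends by finitely many such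
  links.\<close>

lemma discrete_homotopic_select:
  assumes "homotopic_with (\<lambda>_. True) (dom.stage i) (cod.stage n) f g"
  shows "discrete_homotopic (4 * eta n) (select i f) (select i g)"
proof -
  obtain h where h: "continuous_map (prod_topology (top_of_set {0..1::real}) (dom.stage i)) (cod.stage n) h"
    and h01: "\<forall>x. h (0, x) = f x" "\<forall>x. h (1, x) = g x"
    using assms unfolding homotopic_with_def by blast
  have cont: "continuous_map (dom.stage i) (cod.stage n) (\<lambda>C. h (t, C))" if "t \<in> {0..1}" for t
    using continuous_map_o_Pair[OF h, of t] that by (simp add: o_def)
  have "discrete_homotopic (4 * eta n) (select i (\<lambda>C. h (0, C))) (select i (\<lambda>C. h (1, C)))"
  proof (rule connected_equivalence_relation[of "{0..1::real}" 0 1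
        "\<lambda>s t. discrete_homotopic (4 * eta n) (select i (\<lambda>C. h (s, C))) (select i (\<lambda>C. h (t, C)))"])
    fix t :: real assume t: "t \<in> {0..1}"
    obtain T where T: "openin (top_of_set {0..1}) T" "t \<in> T" "\<forall>s\<in>T. \<forall>C\<in>dom.U i. h (s, C) \<subseteq> h (t, C)"
      by (rule homotopy_downset_topology_local[OF h[unfolded fa_spaces_def] dom.finite_U t])
    have "discrete_homotopic (4 * eta n) (select i (\<lambda>C. h (t, C))) (select i (\<lambda>C. h (s, C)))" if s: "s \<in> T" for s
    proof (rule contiguous_imp_discrete_homotopic, rule contiguous_selections[OF cont[OF t]])
      have s01: "s \<in> {0..1}" using T(1) s openin_imp_subset by blast
      show "select i (\<lambda>C. h (t, C)) x \<in> h (t, dom.near i x) \<and> dom.near i x \<in> dom.U i" if "x \<in> X" for x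
        using select_in(1)[OF stage_map_funcset[OF cont[OF t]] that] dom.near_in_U[OF that] by simp
      show "select i (\<lambda>C. h (s, C)) x \<in> h (t, dom.near i x) \<and> dom.near i x \<in> dom.U i" if "x \<in> X" for x
        using select_in(1)[OF stage_map_funcset[OF cont[OF s01]] that] dom.near_in_U[OF that] T(3) s by blast
      show "dom.near i x \<union> dom.near i y \<in> dom.U i \<and> dom.near i x \<union> dom.near i y \<in> dom.U i \<and>
          dom.near i x \<union> dom.near i y \<in> dom.U i" if "x \<in> X" "y \<in> X" "d x y < 2 * eps i" for x y
        using near_Un_near_in_U[OF that] by blast
    qed (use dom.eps_pos[of i] in simp)
    then show "\<exists>T. openin (top_of_set {0..1}) T \<and> t \<in> T \<and>
        (\<forall>s\<in>T. discrete_homotopic (4 * eta n) (select i (\<lambda>C. h (t, C))) (select i (\<lambda>C. h (s, C))))"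
      using T(1,2) by blast
  next
    show "discrete_homotopic (4 * eta n) u w"
      if "discrete_homotopic (4 * eta n) u v" "discrete_homotopic (4 * eta n) v w" for u v w
      using that by (rule discrete_homotopic_trans)
    show "discrete_homotopic (4 * eta n) v u" if "discrete_homotopic (4 * eta n) u v" for u v
      using that by (rule discrete_homotopic_sym)
  qed simp_all
  then show ?thesis using h01 by simp
qed

text \<open>A composite bond contributes \<open>2 * eps i - 2 * eps j\<close> and the projection at
  level j another \<open>eps j\<close>, so all sets involved lie within
  \<open>2 * eps i - eps j\<close> of x or y. Twice this leaves \<open>2 * eps j\<close> for the
  distance of x and y.\<close>

lemma near_Un_bonds_in_U:
  assumes "i \<le> j" "x \<in> X" "y \<in> X" "d x y < 2 * eps j"
    and W: "W \<subseteq> A i" "W \<noteq> {}" "W \<subseteq> dom.near i x \<union> dom.near i y \<union>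
      bonds dom.bonding i j (dom.near j x) \<union> bonds dom.bonding i j (dom.near j y)"
  shows "W \<in> dom.U i"
proof (rule dom.thicken_in_U[where C = "{x, y}" and r = "2 * eps i - eps j"])
  have le: "eps j \<le> eps i" using dom.eps_antimono[OF assms(1)] .
  have near: "d w z \<le> 2 * eps i - eps j" if "w \<in> dom.near i z" for w z
    using dom.near_dist[OF that] le by simp
  have far: "d w z \<le> 2 * eps i - eps j" if w: "w \<in> bonds dom.bonding i j (dom.near j z)" and z: "z \<in> X" for w z
  proof -
    obtain c where c: "c \<in> dom.near j z" "d w c \<le> 2 * eps i - 2 * eps j"
      using dom.bonds_dist[OF assms(1) dom.near_subset(2) w] by blast
    have "d w z \<le> d w c + d c z"
      using dom.bonds_subset[OF assms(1) dom.near_subset(2)] w c dom.in_M_if_near z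
      by (intro dom.triangle) auto
    then show ?thesis using c dom.near_dist[of c j z] by simp
  qed
  show "\<forall>w\<in>W. \<exists>c\<in>{x, y}. d w c \<le> 2 * eps i - eps j"
    using W(3) near far assms(2,3) by blast
qed (use assms dom.eps_pos[of j] in \<open>auto simp: dom.commute\<close>)

lemma contiguous_select_bonds:
  assumes h: "continuous_map (dom.stage i) (cod.stage n) h" and "i \<le> j"
  shows "contiguous (4 * eta n) (select i h) (select j (h \<circ> bonds dom.bonding i j))"
proof (rule contiguous_selections[OF h, of "2 * eps j"])
  let ?Q = "\<lambda>x. bonds dom.bonding i j (dom.near j x)"
  have Q: "?Q x \<in> dom.U i" if "x \<in> X" for x
    using dom.bonds_in_U[OF dom.near_in_U[OF that] \<open>i \<le> j\<close>] .
  have hQ: "h \<circ> bonds dom.bonding i j \<in> dom.U j \<rightarrow> cod.U n"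
    using stage_map(1)[OF h] dom.bonds_in_U \<open>i \<le> j\<close> by auto
  show "select i h x \<in> h (dom.near i x) \<and> dom.near i x \<in> dom.U i" if "x \<in> X" for x
    using select_in(1)[OF stage_map_funcset[OF h] that] dom.near_in_U[OF that] by simp
  show "select j (h \<circ> bonds dom.bonding i j) x \<in> h (?Q x) \<and> ?Q x \<in> dom.U i" if "x \<in> X" for x
    using select_in(1)[OF hQ that] Q[OF that] by simp
  show "dom.near i x \<union> dom.near i y \<in> dom.U i \<and> ?Q x \<union> ?Q y \<in> dom.U i \<and> dom.near i x \<union> ?Q y \<in> dom.U i"
    if xy: "x \<in> X" "y \<in> X" "d x y < 2 * eps j" for x y
  proof -
    have sub: "dom.near i x \<subseteq> A i" "dom.near i y \<subseteq> A i" "?Q x \<subseteq> A i" "?Q y \<subseteq> A i"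
      and ne: "dom.near i x \<noteq> {}" "?Q x \<noteq> {}"
      using Q[OF xy(1)] Q[OF xy(2)] dom.near_in_U[OF xy(1), of i] dom.near_in_U[OF xy(2), of i]
      by (auto simp: dom.U_iff)
    show ?thesis
      using sub ne by (intro conjI near_Un_bonds_in_U[OF \<open>i \<le> j\<close> xy]) auto
  qed
qed (use dom.eps_pos[of j] in simp)

lemma contiguous_select_bonding:
  assumes h: "continuous_map (dom.stage i) (cod.stage (Suc n)) h"
  shows "contiguous (4 * eta n) (select i h) (select i (cod.bonding n \<circ> h))"
proof (rule contiguousI[of _ _ "2 * eps i"])
  let ?u = "select i h" and ?v = "select i (cod.bonding n \<circ> h)"
  have q: "cod.bonding n \<circ> h \<in> dom.U i \<rightarrow> cod.U n"
    using stage_map_funcset[OF h] continuous_map_funspace[OF cod.continuous_map_bonding[of n]] by fastforce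
  note u = select_in[OF stage_map_funcset[OF h]] and v = select_in[OF q]
  show "?u \<in> X \<rightarrow> Y" "?v \<in> X \<rightarrow> Y" using u v by auto
  fix x y assume xy: "x \<in> X" "y \<in> X" "d x y < 2 * eps i"
  let ?H = "h (dom.near i x \<union> dom.near i y)"
  have nn: "dom.near i x \<union> dom.near i y \<in> dom.U i" by (rule near_Un_near_in_U[OF xy])
  then have HU: "?H \<in> cod.U (Suc n)" by (rule stage_map(1)[OF h])
  then have HY: "?H \<subseteq> Y" by (rule cod.U_subset)
  have sub: "h (dom.near i z) \<subseteq> ?H" if "z \<in> {x, y}" for z
    using stage_map(2)[OF h nn dom.near_in_U[of z]] that xy by blast
  then have qsub: "cod.bonding n (h (dom.near i z)) \<subseteq> cod.bonding n ?H" if "z \<in> {x, y}" for z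
    using that unfolding cod.bonding_eq by blast
  \<comment> \<open>All four values lie within \<open>eta n\<close> of ?H, whose diameter is below
    \<open>4 * eta (Suc n)\<close> and hence below \<open>2 * eta n\<close>; together this stays
    under \<open>4 * eta n\<close>.\<close>
  have near: "\<exists>c\<in>?H. l w c \<le> eta n" if w: "w \<in> {?u x, ?u y, ?v x, ?v y}" for w
  proof -
    have "w \<in> ?H \<or> w \<in> cod.bonding n ?H"
      using w u(1)[of x] u(1)[of y] v(1)[of x] v(1)[of y] xy sub[of x] sub[of y] qsub[of x] qsub[of y]
      by auto
    moreover have "l w w \<le> eta n" if "w \<in> ?H" using that HY cod.eps_pos[of n] by auto
    ultimately show ?thesis using cod.near_dist[of w n] unfolding cod.bonding_eq by (meson UN_E less_imp_le)
  qed
  have "l a b < 4 * eta n" if ab: "a \<in> {?u x, ?u y, ?v x, ?v y}" "b \<in> {?u x, ?u y, ?v x, ?v y}" for a b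
  proof -
    obtain c c' where c: "c \<in> ?H" "l a c \<le> eta n" "c' \<in> ?H" "l b c' \<le> eta n"
      using near[OF ab(1)] near[OF ab(2)] by blast
    have "l c c' < 4 * eta (Suc n)" using c HU by (simp add: cod.U_iff)
    then have "l c c' < 2 * eta n" using cod.eps_Suc[of n] by simp
    moreover have "a \<in> Y" "b \<in> Y" using ab u(2) v(2) xy by auto
    ultimately show ?thesis using cod.thicken_dist[of a b c c' "eta n" "2 * eta n"] c HY by auto
  qed
  then show "l (?u x) (?u y) < 4 * eta n \<and> l (?v x) (?v y) < 4 * eta n \<and> l (?u x) (?v y) < 4 * eta n"
    by blast
qed (use dom.eps_pos[of i] in simp)

text \<open>The pointwise union is again order preserving and lies above both f and g, so it joins
  them by two comparisons as soon as its values are small enough.\<close>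

lemma homotopic_contiguous:
  assumes f: "\<And>C D. C \<in> dom.U m \<Longrightarrow> D \<in> dom.U m \<Longrightarrow> D \<subseteq> C \<Longrightarrow> f D \<subseteq> f C"
    and g: "\<And>C D. C \<in> dom.U m \<Longrightarrow> D \<in> dom.U m \<Longrightarrow> D \<subseteq> C \<Longrightarrow> g D \<subseteq> g C"
    and ne: "\<And>C. C \<in> dom.U m \<Longrightarrow> f C \<noteq> {} \<and> g C \<noteq> {}"
    and fg: "\<And>C. C \<in> dom.U m \<Longrightarrow> f C \<union> g C \<in> cod.U n"
  shows "homotopic_with (\<lambda>_. True) (dom.stage m) (cod.stage n) f g"
proof -
  have U: "f C \<in> cod.U n" "g C \<in> cod.U n" if "C \<in> dom.U m" for C
    using fg[OF that] ne[OF that] by (auto simp: cod.U_iff)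
  let ?k = "\<lambda>C. f C \<union> g C"
  have "\<forall>C\<in>dom.U m. \<forall>D\<in>dom.U m. D \<subseteq> C \<longrightarrow> ?k D \<subseteq> ?k C" using f g by blast
  then have cont: "continuous_map (dom.stage m) (cod.stage n) f"
    "continuous_map (dom.stage m) (cod.stage n) g" "continuous_map (dom.stage m) (cod.stage n) ?k"
    unfolding fa_spaces_def continuous_map_downset_topology using U f g fg by auto
  have "homotopic_with (\<lambda>_. True) (dom.stage m) (cod.stage n) f ?k"
    "homotopic_with (\<lambda>_. True) (dom.stage m) (cod.stage n) g ?k"
    unfolding fa_spaces_def
    by (rule homotopic_downset_topology_le; use cont in \<open>auto simp: fa_spaces_def\<close>)+
  then show ?thesis using homotopic_with_symD homotopic_with_trans by blast
qed

section \<open>From functions to maps of stages by discretization\<close>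

lemma discretize_mono: "D \<subseteq> C \<Longrightarrow> discretize n u D \<subseteq> discretize n u C"
  by (auto simp: discretize_def)

lemma discretize_subset: "discretize n u C \<subseteq> B n"
  using cod.near_subset by (auto simp: discretize_def)

lemma discretize_nonempty: "C \<noteq> {} \<Longrightarrow> u ` C \<subseteq> Y \<Longrightarrow> discretize n u C \<noteq> {}"
  using cod.near_nonempty by (fastforce simp: discretize_def)

lemma discretize_dist: "w \<in> discretize n u C \<Longrightarrow> \<exists>c\<in>C. l w (u c) \<le> eta n"
  using cod.near_dist[of w n] unfolding discretize_def by (meson UN_E less_imp_le)

text \<open>One round trip: discretizing a selection of h gives back h up to composition with bonds
  on both sides. The strict inequalities are needed for \<open>2 * eps m < eps j\<close> and
  \<open>2 * eta N < eta n\<close>, which let a single projection fit within the allowance for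
  composite bonds.\<close>

lemma discretize_select:
  assumes h: "continuous_map (dom.stage j) (cod.stage N) h" and "j < m" "n < N"
  shows "homotopic_with (\<lambda>_. True) (dom.stage m) (cod.stage n)
    (discretize n (select j h)) (bonds cod.bonding n N \<circ> h \<circ> bonds dom.bonding j m)"
proof (rule homotopic_contiguous)
  let ?u = "select j h" and ?g = "bonds cod.bonding n N \<circ> h \<circ> bonds dom.bonding j m"
  note u = select_in[OF stage_map_funcset[OF h]]
  have "continuous_map (dom.stage m) (cod.stage n) ?g"
    using \<open>j < m\<close> \<open>n < N\<close> h
    by (intro continuous_map_compose[of _ "dom.stage j"] continuous_map_compose[of _ "cod.stage N"]
        dom.continuous_map_stage_bonds cod.continuous_map_stage_bonds) auto
  note g = stage_map[OF this]
  show "discretize n ?u D \<subseteq> discretize n ?u C" if "D \<subseteq> C" for C D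
    using that by (rule discretize_mono)
  show "?g D \<subseteq> ?g C" if "C \<in> dom.U m" "D \<in> dom.U m" "D \<subseteq> C" for C D
    using that by (rule g(2))
  fix C assume C: "C \<in> dom.U m"
  then have CX: "C \<subseteq> X" "C \<noteq> {}" using dom.U_subset by (auto simp: dom.U_iff)
  have uY: "?u ` C \<subseteq> Y" using u(2) CX by auto
  show ne: "discretize n ?u C \<noteq> {} \<and> ?g C \<noteq> {}"
    using discretize_nonempty[OF CX(2) uY] g(1)[OF C] by (auto simp: cod.U_iff)
  let ?b = "bonds dom.bonding j m C"
  \<comment> \<open>?W contains all sets at which values of ?u are selected on C, and the argument
    that ?g passes to h. By the budget it is still in \<open>dom.U j\<close>, so one value
    \<open>h ?W\<close> controls both maps.\<close>
  let ?W = "(\<Union>c\<in>C. dom.near j c) \<union> ?b"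
  have bU: "?b \<in> dom.U j" using dom.bonds_in_U[OF C] \<open>j < m\<close> by simp
  have WU: "?W \<in> dom.U j"
  proof (rule dom.thicken_in_U[where C = C and r = "2 * eps j - 2 * eps m"])
    show "?W \<subseteq> A j" "?W \<noteq> {}" using bU dom.near_subset by (auto simp: dom.U_iff)
    have "\<exists>c\<in>C. d w c \<le> 2 * eps j - 2 * eps m" if "w \<in> ?b" for w
      using dom.bonds_dist[of j m C w] \<open>j < m\<close> CX that by simp
    moreover have "d w c \<le> 2 * eps j - 2 * eps m" if "w \<in> dom.near j c" for w c
      using dom.near_dist[OF that] dom.eps_half[OF \<open>j < m\<close>] by simp
    ultimately show "\<forall>w\<in>?W. \<exists>c\<in>C. d w c \<le> 2 * eps j - 2 * eps m" by blast
    show "\<forall>c\<in>C. \<forall>c'\<in>C. d c c' < 4 * eps j - 2 * (2 * eps j - 2 * eps m)"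
      using C by (auto simp: dom.U_iff)
  qed (rule CX)
  have HU: "h ?W \<in> cod.U N" by (rule stage_map(1)[OF h WU])
  then have HY: "h ?W \<subseteq> Y" by (rule cod.U_subset)
  have uH: "?u c \<in> h ?W" if "c \<in> C" for c
  proof -
    have "h (dom.near j c) \<subseteq> h ?W"
      by (rule stage_map(2)[OF h WU dom.near_in_U]) (use that CX in auto)
    then show ?thesis using u(1)[of c] that CX by blast
  qed
  have bH: "h ?b \<subseteq> h ?W" by (rule stage_map(2)[OF h WU bU]) auto
  show "discretize n ?u C \<union> ?g C \<in> cod.U n"
  proof (rule cod.thicken_in_U[where C = "h ?W" and r = "2 * eta n - 2 * eta N"])
    show "discretize n ?u C \<union> ?g C \<subseteq> B n" using discretize_subset g(1)[OF C] by (auto simp: cod.U_iff)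
    show "discretize n ?u C \<union> ?g C \<noteq> {}" using ne by simp
    have "\<exists>c\<in>h ?W. l w c \<le> 2 * eta n - 2 * eta N" if w: "w \<in> ?g C" for w
      using cod.bonds_dist[of n N "h ?b" w] \<open>n < N\<close> bH HY w by fastforce
    moreover have "\<exists>c\<in>h ?W. l w c \<le> 2 * eta n - 2 * eta N" if w: "w \<in> discretize n ?u C" for w
    proof -
      obtain c where "c \<in> C" "l w (?u c) \<le> eta n" using discretize_dist[OF w] by blast
      then show ?thesis using uH[of c] cod.eps_half[OF \<open>n < N\<close>] by (intro bexI[of _ "?u c"]) auto
    qed
    ultimately show "\<forall>w\<in>discretize n ?u C \<union> ?g C. \<exists>c\<in>h ?W. l w c \<le> 2 * eta n - 2 * eta N" by blast
    show "\<forall>c\<in>h ?W. \<forall>c'\<in>h ?W. l c c' < 4 * eta n - 2 * (2 * eta n - 2 * eta N)"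
      using HU by (auto simp: cod.U_iff)
  qed (rule HY)
qed

text \<open>Discretizing costs \<open>eta n\<close> at either end, so contiguity at
  \<open>2 * eta n\<close> is what \<open>4 * eta n\<close> allows. The level N depends on the scale
  of the link; a finite chain takes the maximum.\<close>

lemma homotopic_discretize:
  assumes uv: "discrete_homotopic (2 * eta n) u v"
  shows "\<exists>N. \<forall>m\<ge>N. homotopic_with (\<lambda>_. True) (dom.stage m) (cod.stage n) (discretize n u) (discretize n v)"
proof -
  have contig: "\<exists>N. \<forall>m\<ge>N. homotopic_with (\<lambda>_. True) (dom.stage m) (cod.stage n) (discretize n u) (discretize n v)"
    if uv: "contiguous (2 * eta n) u v" for u v
  proof -
    obtain \<delta> where \<delta>: "\<delta> > 0" and uY: "u \<in> X \<rightarrow> Y" "v \<in> X \<rightarrow> Y" and close: "\<forall>x\<in>X. \<forall>y\<in>X. d x y < \<delta> \<longrightarrow>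
        l (u x) (u y) < 2 * eta n \<and> l (v x) (v y) < 2 * eta n \<and> l (u x) (v y) < 2 * eta n"
      using uv unfolding contiguous_def by blast
    obtain N where N: "\<forall>m\<ge>N. eps m < \<delta> / 4" using dom.eps_small[of "\<delta> / 4"] \<delta> by auto
    have "homotopic_with (\<lambda>_. True) (dom.stage m) (cod.stage n) (discretize n u) (discretize n v)"
      if m: "N \<le> m" for m
    proof (rule homotopic_contiguous)
      fix C assume C: "C \<in> dom.U m"
      then have CX: "C \<subseteq> X" "C \<noteq> {}" and dC: "\<forall>a\<in>C. \<forall>b\<in>C. d a b < 4 * eps m"
        using dom.U_subset by (auto simp: dom.U_iff)
      show ne: "discretize n u C \<noteq> {} \<and> discretize n v C \<noteq> {}"
        using CX uY by (intro conjI discretize_nonempty) auto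
      show "discretize n u C \<union> discretize n v C \<in> cod.U n"
      proof (rule cod.thicken_in_U[where C = "u ` C \<union> v ` C" and r = "eta n"])
        show "\<forall>w\<in>discretize n u C \<union> discretize n v C. \<exists>c\<in>u ` C \<union> v ` C. l w c \<le> eta n"
          using discretize_dist by fast
        have "d a b < \<delta>" if "a \<in> C" "b \<in> C" for a b using dC N m that by fastforce
        then have "l (u a) (u b) < 2 * eta n \<and> l (v a) (v b) < 2 * eta n \<and> l (u a) (v b) < 2 * eta n"
          if "a \<in> C" "b \<in> C" for a b
          using close CX that by blast
        then show "\<forall>c\<in>u ` C \<union> v ` C. \<forall>c'\<in>u ` C \<union> v ` C. l c c' < 4 * eta n - 2 * eta n"
          by (auto simp: cod.commute)
      qed (use ne discretize_subset uY CX in auto)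
    qed (rule discretize_mono, assumption)+
    then show ?thesis by blast
  qed
  show ?thesis
    using uv unfolding discrete_homotopic_def
  proof induction
    case (base v)
    then show ?case by (rule contig)
  next
    case (step v w)
    then obtain N M where
      N: "\<forall>m\<ge>N. homotopic_with (\<lambda>_. True) (dom.stage m) (cod.stage n) (discretize n u) (discretize n v)" and
      M: "\<forall>m\<ge>M. homotopic_with (\<lambda>_. True) (dom.stage m) (cod.stage n) (discretize n v) (discretize n w)"
      using contig[OF step(2)] by blast
    have "homotopic_with (\<lambda>_. True) (dom.stage m) (cod.stage n) (discretize n u) (discretize n w)"
      if "max N M \<le> m" for m
      by (rule homotopic_with_trans) (use N M that in auto)
    then show ?case by blast
  qed
qed

lemma homotopic_discretize_bonds:
  assumes u: "u \<in> X \<rightarrow> Y" "\<forall>x\<in>X. \<forall>y\<in>X. d x y < 4 * eps i \<longrightarrow> l (u x) (u y) < 2 * eta n" and "i \<le> m"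
  shows "homotopic_with (\<lambda>_. True) (dom.stage m) (cod.stage n)
    (discretize n u) (discretize n u \<circ> bonds dom.bonding i m)"
proof (rule homotopic_contiguous)
  show "discretize n u D \<subseteq> discretize n u C" if "D \<subseteq> C" for C D
    using that by (rule discretize_mono)
  show "(discretize n u \<circ> bonds dom.bonding i m) D \<subseteq> (discretize n u \<circ> bonds dom.bonding i m) C"
    if "C \<in> dom.U m" "D \<in> dom.U m" "D \<subseteq> C" for C D
  proof -
    have "bonds dom.bonding i m D \<subseteq> bonds dom.bonding i m C"
      using dom.continuous_map_stage_bonds[OF \<open>i \<le> m\<close>] that
      unfolding fa_spaces_def continuous_map_downset_topology by blast
    then show ?thesis by (simp add: discretize_mono)
  qed
  fix C assume C: "C \<in> dom.U m"
  let ?b = "bonds dom.bonding i m C"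
  have CX: "C \<subseteq> X" "C \<noteq> {}" using C dom.U_subset by (auto simp: dom.U_iff)
  have b: "?b \<in> dom.U i" by (rule dom.bonds_in_U[OF C \<open>i \<le> m\<close>])
  then have bX: "?b \<subseteq> X" "?b \<noteq> {}" using dom.U_subset by (auto simp: dom.U_iff)
  have "discretize n u C \<noteq> {}" "discretize n u ?b \<noteq> {}"
    using u(1) CX bX by (intro discretize_nonempty; blast)+
  then show ne: "discretize n u C \<noteq> {} \<and> (discretize n u \<circ> bonds dom.bonding i m) C \<noteq> {}" by simp
  have un: "discretize n u C \<union> (discretize n u \<circ> bonds dom.bonding i m) C = discretize n u (C \<union> ?b)"
    by (auto simp: discretize_def)
  show "discretize n u C \<union> (discretize n u \<circ> bonds dom.bonding i m) C \<in> cod.U n"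
    unfolding un
  proof (rule cod.thicken_in_U[where C = "u ` (C \<union> ?b)" and r = "eta n"])
    show "\<forall>w\<in>discretize n u (C \<union> ?b). \<exists>c\<in>u ` (C \<union> ?b). l w c \<le> eta n"
      using discretize_dist by fast
    have near: "\<exists>c\<in>C. d w c \<le> 2 * eps i - 2 * eps m" if w: "w \<in> C \<union> ?b" for w
    proof (cases "w \<in> C")
      case True
      then have "d w w \<le> 2 * eps i - 2 * eps m" using CX dom.eps_antimono[OF \<open>i \<le> m\<close>] by auto
      then show ?thesis using True by blast
    next
      case False
      then show ?thesis using dom.bonds_dist[OF \<open>i \<le> m\<close> CX(1)] w by blast
    qed
    \<comment> \<open>The budget again, now explaining the modulus in the hypothesis: C and its
      image under the bonds together still have diameter below \<open>4 * eps i\<close>.\<close>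
    have "d a b < 4 * eps i" if ab: "a \<in> C \<union> ?b" "b \<in> C \<union> ?b" for a b
    proof -
      obtain c c' where c: "c \<in> C" "d a c \<le> 2 * eps i - 2 * eps m" "c' \<in> C" "d b c' \<le> 2 * eps i - 2 * eps m"
        using near[OF ab(1)] near[OF ab(2)] by blast
      then have "d c c' < 4 * eps m" using C by (simp add: dom.U_iff)
      then show ?thesis
        using dom.thicken_dist[of a b c c' "2 * eps i - 2 * eps m" "4 * eps m"] c CX bX ab by auto
    qed
    then show "\<forall>c\<in>u ` (C \<union> ?b). \<forall>c'\<in>u ` (C \<union> ?b). l c c' < 4 * eta n - 2 * eta n"
      using u(2) CX bX by (simp add: ball_Un) blast
  qed (use ne un discretize_subset u(1) CX bX in auto)
qed

lemma homotopic_bonding_discretize: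
  assumes u: "u \<in> X \<rightarrow> Y" "\<forall>x\<in>X. \<forall>y\<in>X. d x y < 4 * eps m \<longrightarrow> l (u x) (u y) < eta n"
  shows "homotopic_with (\<lambda>_. True) (dom.stage m) (cod.stage n)
    (cod.bonding n \<circ> discretize (Suc n) u) (discretize n u)"
proof (rule homotopic_contiguous)
  show "discretize n u D \<subseteq> discretize n u C" if "D \<subseteq> C" for C D
    using that by (rule discretize_mono)
  show "(cod.bonding n \<circ> discretize (Suc n) u) D \<subseteq> (cod.bonding n \<circ> discretize (Suc n) u) C" if "D \<subseteq> C" for C D
    using discretize_mono[OF that, of "Suc n" u] by (auto simp: cod.bonding_eq)
  fix C assume C: "C \<in> dom.U m"
  let ?S = "discretize (Suc n) u C"
  have CX: "C \<subseteq> X" "C \<noteq> {}" using C dom.U_subset by (auto simp: dom.U_iff)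
  have uC: "u ` C \<subseteq> Y" using u CX by auto
  have SY: "?S \<subseteq> Y" using discretize_subset cod.A_subset by blast
  have "?S \<noteq> {}" "discretize n u C \<noteq> {}" using CX uC by (intro discretize_nonempty; blast)+
  moreover from this have "cod.bonding n ?S \<noteq> {}"
    using SY cod.near_nonempty unfolding cod.bonding_eq by blast
  ultimately show ne: "(cod.bonding n \<circ> discretize (Suc n) u) C \<noteq> {} \<and> discretize n u C \<noteq> {}" by simp
  show "(cod.bonding n \<circ> discretize (Suc n) u) C \<union> discretize n u C \<in> cod.U n"
  \<comment> \<open>The path through level Suc n moves by \<open>eta (Suc n) + eta n\<close>, less
    than \<open>3/2 * eta n\<close>. Doubling leaves \<open>eta n\<close>, the oscillation of u
    allowed by the hypothesis.\<close>
  proof (rule cod.thicken_in_U[where C = "u ` C" and r = "3/2 * eta n"])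
    have "\<exists>c\<in>u ` C. l w c \<le> 3/2 * eta n" if w: "w \<in> cod.bonding n ?S" for w
    proof -
      obtain b where b: "b \<in> ?S" "w \<in> cod.near n b" using w by (auto simp: cod.bonding_eq)
      then obtain c where c: "c \<in> C" "l b (u c) \<le> eta (Suc n)" using discretize_dist by blast
      have "l w (u c) \<le> l w b + l b (u c)"
        using b c SY uC cod.in_M_if_near by (intro cod.triangle) auto
      then show ?thesis using c cod.near_dist[OF b(2)] cod.eps_Suc[of n] by (intro bexI[of _ "u c"]) auto
    qed
    moreover have "\<exists>c\<in>u ` C. l w c \<le> 3/2 * eta n" if w: "w \<in> discretize n u C" for w
      
    proof -
      obtain c where "c \<in> C" "l w (u c) \<le> eta n" using discretize_dist[OF w] by blast
      then show ?thesis using cod.eps_pos[of n] by (intro bexI[of _ "u c"]) auto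
    qed
    ultimately show "\<forall>w\<in>(cod.bonding n \<circ> discretize (Suc n) u) C \<union> discretize n u C. \<exists>c\<in>u ` C. l w c \<le> 3/2 * eta n"
      by auto
    show "\<forall>c\<in>u ` C. \<forall>c'\<in>u ` C. l c c' < 4 * eta n - 2 * (3/2 * eta n)"
    proof clarsimp
      fix c c' assume "c \<in> C" "c' \<in> C"
      moreover from this have "d c c' < 4 * eps m" using C by (simp add: dom.U_iff)
      ultimately show "l (u c) (u c') < eta n" using u(2) CX by blast
    qed
    show "(cod.bonding n \<circ> discretize (Suc n) u) C \<union> discretize n u C \<subseteq> B n"
      using discretize_subset cod.near_subset(1)[of n] by (fastforce simp: cod.bonding_eq)
  qed (use ne uC in auto)
qed

lemma contiguous_select_discretize:
  assumes u: "u \<in> X \<rightarrow> Y" "\<forall>x\<in>X. \<forall>y\<in>X. d x y < 4 * eps i \<longrightarrow> l (u x) (u y) < eta n"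
  shows "contiguous (4 * eta n) (select i (discretize n u)) u"
proof (rule contiguousI[of _ _ "eps i"])
  let ?v = "select i (discretize n u)"
  have v: "?v x \<in> discretize n u (dom.near i x)" if x: "x \<in> X" for x
  proof -
    have "discretize n u (dom.near i x) \<noteq> {}"
      using dom.near_nonempty[OF x] dom.in_M_if_near u(1) by (intro discretize_nonempty) blast+
    then show ?thesis unfolding select_def by (rule some_in_eq[THEN iffD2])
  qed
  then show "?v \<in> X \<rightarrow> Y" using discretize_subset cod.A_subset by blast
  fix x y assume xy: "x \<in> X" "y \<in> X" "d x y < eps i"
  have near: "\<exists>c\<in>X. d c z < eps i \<and> l w (u c) \<le> eta n"
    if z: "z \<in> X" and w: "w = ?v z \<or> w = u z" for w z
  proof (cases "w = u z")
    case True
    then show ?thesis using z u(1) dom.eps_pos[of i] cod.eps_pos[of n] by (intro bexI[of _ z]) (auto simp: Pi_iff)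
  next
    case False
    then obtain c where "c \<in> dom.near i z" "l w (u c) \<le> eta n"
      using discretize_dist[OF v[OF z]] w by blast
    then show ?thesis using dom.in_M_if_near dom.near_dist by blast
  qed
  have close: "l w w' < 4 * eta n"
    if w: "w = ?v z \<or> w = u z" "w' = ?v z' \<or> w' = u z'" and z: "z \<in> X" "z' \<in> X" "d z z' < eps i" for w w' z z'
  proof -
    obtain c c' where c: "c \<in> X" "d c z < eps i" "l w (u c) \<le> eta n"
      and c': "c' \<in> X" "d c' z' < eps i" "l w' (u c') \<le> eta n"
      using near[OF z(1) w(1)] near[OF z(2) w(2)] by blast
    \<comment> \<open>Three lengths of \<open>eps i\<close> stay below the modulus
      \<open>4 * eps i\<close>; on the side of Y likewise three of \<open>eta n\<close> below
      \<open>4 * eta n\<close>.\<close>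
    have "d c c' < eps i + 2 * eps i"
      using dom.thicken_dist[of c c' z z' "eps i" "eps i"] c c' z by simp
    then have "l (u c) (u c') < eta n" using u(2) c(1) c'(1) dom.eps_pos[of i] by simp
    moreover have "w \<in> Y" "w' \<in> Y" using w z u(1) \<open>?v \<in> X \<rightarrow> Y\<close> by auto
    ultimately have "l w w' < eta n + 2 * eta n"
      using u(1) c c' by (intro cod.thicken_dist[of w w' "u c" "u c'"]) auto
    then show ?thesis using cod.eps_pos[of n] by simp
  qed
  show "l (?v x) (?v y) < 4 * eta n \<and> l (u x) (u y) < 4 * eta n \<and> l (?v x) (u y) < 4 * eta n"
    using close[of _ x _ y] xy by blast
qed (use u dom.eps_pos[of i] in auto)

section \<open>Representatives in pro-HTop and discrete sequences\<close>

abbreviation "reps \<equiv> pro_reps dom.stage dom.bonding cod.stage cod.bonding"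
abbreviation "reps_equiv \<equiv> pro_equiv dom.stage dom.bonding cod.stage cod.bonding"

definition select_sequence :: "(nat \<Rightarrow> nat) \<times> (nat \<Rightarrow> 'a set \<Rightarrow> 'b set) \<Rightarrow> nat \<Rightarrow> 'a \<Rightarrow> 'b" where
  "select_sequence F n = select (fst F n) (snd F n)"

lemma reps_continuous: "(f, fs) \<in> reps \<Longrightarrow> continuous_map (dom.stage (f n)) (cod.stage n) (fs n)"
  by (simp add: pro_reps_def)

text \<open>Consecutive terms are joined in three moves: refining the stage of the source, the
  homotopy of the representative, and undoing the bonding map of the target. Each works at scale
  \<open>4 * eta n\<close>, which tends to 0.\<close>

lemma select_sequence_in:
  assumes F: "(f, fs) \<in> reps"
  shows "select_sequence (f, fs) \<in> discrete_sequences"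
proof -
  have hom: "discrete_homotopic (4 * eta n) (select_sequence (f, fs) n) (select_sequence (f, fs) (Suc n))" for n
  proof -
    have f: "f n \<le> f (Suc n)" using F by (auto simp: pro_reps_def monoD)
    have "discrete_homotopic (4 * eta n) (select (f n) (fs n))
        (select (f (Suc n)) (fs n \<circ> bonds dom.bonding (f n) (f (Suc n))))"
      by (intro contiguous_imp_discrete_homotopic contiguous_select_bonds reps_continuous F f)
    also have "discrete_homotopic (4 * eta n) \<dots>
        (select (f (Suc n)) (cod.bonding n \<circ> fs (Suc n)))"
      by (rule discrete_homotopic_sym, rule discrete_homotopic_select) (use F in \<open>auto simp: pro_reps_def\<close>)
    also have "discrete_homotopic (4 * eta n) \<dots> (select (f (Suc n)) (fs (Suc n)))"
      by (rule discrete_homotopic_sym)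
        (intro contiguous_imp_discrete_homotopic contiguous_select_bonding reps_continuous F)
    finally show ?thesis by (simp add: select_sequence_def)
  qed
  have "\<exists>N. \<forall>n\<ge>N. discrete_homotopic e (select_sequence (f, fs) n) (select_sequence (f, fs) (Suc n))" if "e > 0" for e
  proof -
    obtain N where N: "\<forall>n\<ge>N. eta n < e / 4" using cod.eps_small[of "e / 4"] \<open>e > 0\<close> by auto
    have "discrete_homotopic e (select_sequence (f, fs) n) (select_sequence (f, fs) (Suc n))" if "N \<le> n" for n
      by (rule discrete_homotopic_mono[OF hom]) (use N that in fastforce)
    then show ?thesis by blast
  qed
  then show ?thesis by (simp add: discrete_sequences_def)
qed

lemma select_sequence_equiv:
  assumes FG: "((f, fs), (g, gs)) \<in> reps_equiv"
  shows "(select_sequence (f, fs), select_sequence (g, gs)) \<in> discrete_equiv"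
proof -
  have F: "(f, fs) \<in> reps" and G: "(g, gs) \<in> reps" using FG by (auto simp: pro_equiv_def)
  have hom: "discrete_homotopic (4 * eta n) (select_sequence (f, fs) n) (select_sequence (g, gs) n)" for n
  proof -
    obtain m where m: "f n \<le> m" "g n \<le> m" "homotopic_with (\<lambda>_. True) (dom.stage m) (cod.stage n)
        (fs n \<circ> bonds dom.bonding (f n) m) (gs n \<circ> bonds dom.bonding (g n) m)"
      using FG by (auto simp: pro_equiv_def)
    have "discrete_homotopic (4 * eta n) (select (f n) (fs n)) (select m (fs n \<circ> bonds dom.bonding (f n) m))"
      by (intro contiguous_imp_discrete_homotopic contiguous_select_bonds reps_continuous F m)
    also have "discrete_homotopic (4 * eta n) \<dots> (select m (gs n \<circ> bonds dom.bonding (g n) m))"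
      by (rule discrete_homotopic_select[OF m(3)])
    also have "discrete_homotopic (4 * eta n) \<dots> (select (g n) (gs n))"
      by (rule discrete_homotopic_sym)
        (intro contiguous_imp_discrete_homotopic contiguous_select_bonds reps_continuous G m)
    finally show ?thesis by (simp add: select_sequence_def)
  qed
  show ?thesis
  proof (rule discrete_equivI[OF select_sequence_in[OF G]])
    fix e :: real assume "e > 0"
    then obtain N where N: "\<forall>n\<ge>N. eta n < e / 4" using cod.eps_small[of "e / 4"] by auto
    have "discrete_homotopic e (select_sequence (f, fs) n) (select_sequence (g, gs) n)" if "N \<le> n" for n
      by (rule discrete_homotopic_mono[OF hom]) (use N that in fastforce)
    then show "\<exists>N. \<forall>n\<ge>N. discrete_homotopic e (select_sequence (f, fs) n) (select_sequence (g, gs) n)" by blast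
  qed
qed

text \<open>Every later term N of the selected sequence determines \<open>fs n\<close> up to
  homotopy after passing to a deep stage; so the tail of the sequence remembers the whole
  representative.\<close>

lemma discretize_select_sequence:
  assumes F: "(f, fs) \<in> reps" and "n < N" "f N < m"
  shows "homotopic_with (\<lambda>_. True) (dom.stage m) (cod.stage n)
    (discretize n (select_sequence (f, fs) N)) (fs n \<circ> bonds dom.bonding (f n) m)"
proof -
  have f: "f n \<le> f N" using F \<open>n < N\<close> by (auto simp: pro_reps_def monoD)
  have "homotopic_with (\<lambda>_. True) (dom.stage (f N)) (cod.stage n)
      (bonds cod.bonding n N \<circ> fs N) (fs n \<circ> bonds dom.bonding (f n) (f N))"
    using \<open>n < N\<close>
    by (intro pro_reps_iterate[OF F] dom.continuous_map_bonding cod.continuous_map_bonding) simp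
  from homotopic_with_compose_continuous_map_right[OF this dom.continuous_map_stage_bonds[of "f N" m]]
  have "homotopic_with (\<lambda>_. True) (dom.stage m) (cod.stage n)
      (bonds cod.bonding n N \<circ> fs N \<circ> bonds dom.bonding (f N) m) (fs n \<circ> bonds dom.bonding (f n) m)"
    using \<open>f N < m\<close> bonds_comp[OF f, of m dom.bonding] by (simp add: comp_assoc)
  moreover have "homotopic_with (\<lambda>_. True) (dom.stage m) (cod.stage n)
      (discretize n (select_sequence (f, fs) N)) (bonds cod.bonding n N \<circ> fs N \<circ> bonds dom.bonding (f N) m)"
    unfolding select_sequence_def fst_conv snd_conv
    by (rule discretize_select[OF reps_continuous[OF F] \<open>f N < m\<close> \<open>n < N\<close>])
  ultimately show ?thesis by (rule homotopic_with_trans[rotated])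
qed

lemma select_sequence_equiv_imp:
  assumes F: "(f, fs) \<in> reps" and G: "(g, gs) \<in> reps"
    and FG: "(select_sequence (f, fs), select_sequence (g, gs)) \<in> discrete_equiv"
  shows "((f, fs), (g, gs)) \<in> reps_equiv"
proof -
  have "\<exists>m. f n \<le> m \<and> g n \<le> m \<and> homotopic_with (\<lambda>_. True) (dom.stage m) (cod.stage n)
      (fs n \<circ> bonds dom.bonding (f n) m) (gs n \<circ> bonds dom.bonding (g n) m)" for n
  proof -
    have "\<exists>N. \<forall>k\<ge>N. discrete_homotopic (2 * eta n) (select_sequence (f, fs) k) (select_sequence (g, gs) k)"
      using FG cod.eps_pos[of n] by (simp add: discrete_equiv_def)
    then obtain N0 where
      "\<forall>k\<ge>N0. discrete_homotopic (2 * eta n) (select_sequence (f, fs) k) (select_sequence (g, gs) k)" by blast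
    \<comment> \<open>Discrete equivalence concerns late terms only; a term beyond n can still be
      compared at level n, at the scale \<open>2 * eta n\<close> fixed there.\<close>
    then obtain N where N: "n < N" "discrete_homotopic (2 * eta n) (select_sequence (f, fs) N) (select_sequence (g, gs) N)"
      using that[of "max N0 (Suc n)"] by auto
    obtain M where M: "\<forall>m\<ge>M. homotopic_with (\<lambda>_. True) (dom.stage m) (cod.stage n)
        (discretize n (select_sequence (f, fs) N)) (discretize n (select_sequence (g, gs) N))"
      using homotopic_discretize[OF N(2)] by blast
    define m where "m = Suc (M + f N + g N)"
    have m: "M \<le> m" "f N < m" "g N < m" by (auto simp: m_def)
    have "f n \<le> f N" "g n \<le> g N" using F G N(1) by (auto simp: pro_reps_def monoD)
    moreover have "homotopic_with (\<lambda>_. True) (dom.stage m) (cod.stage n)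
        (fs n \<circ> bonds dom.bonding (f n) m) (gs n \<circ> bonds dom.bonding (g n) m)"
      using homotopic_with_trans[OF homotopic_with_trans[OF homotopic_with_symD[OF
            discretize_select_sequence[OF F N(1) m(2)]]] discretize_select_sequence[OF G N(1) m(3)]]
        M m(1) by blast
    ultimately show ?thesis using m by (intro exI[of _ m]) auto
  qed
  then show ?thesis using F G by (simp add: pro_equiv_def)
qed

text \<open>After passing to a sequence whose n-th step is homotopic at scale \<open>eta n\<close>,
  discretizing the n-th term at level n gives maps that commute with the bonds up to
  homotopy.\<close>

lemma select_sequence_surj:
  assumes v: "v \<in> discrete_sequences"
  shows "\<exists>F\<in>reps. (select_sequence F, v) \<in> discrete_equiv"
proof -
  obtain u where uv: "(u, v) \<in> discrete_equiv" and u: "\<And>n. discrete_homotopic (eta n) (u n) (u (Suc n))"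
    by (rule discrete_sequences_fast[OF v cod.eps_pos]) (rule that)
  have "\<exists>\<delta>>0. u n \<in> X \<rightarrow> Y \<and> (\<forall>x\<in>X. \<forall>y\<in>X. d x y < \<delta> \<longrightarrow> l (u n x) (u n y) < eta n)" for n
  proof -
    have "\<exists>w. contiguous (eta n) (u n) w"
      using u[of n] unfolding discrete_homotopic_def by (rule converse_tranclpE) blast+
    then show ?thesis unfolding contiguous_def by blast
  qed
  then obtain \<delta> where \<delta>: "\<And>n. \<delta> n > 0" and uY: "\<And>n. u n \<in> X \<rightarrow> Y"
    and close: "\<And>n. \<forall>x\<in>X. \<forall>y\<in>X. d x y < \<delta> n \<longrightarrow> l (u n x) (u n y) < eta n"
    by metis
  have "\<exists>N. \<forall>m\<ge>N. 4 * eps m < \<delta> n \<and> homotopic_with (\<lambda>_. True) (dom.stage m) (cod.stage n)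
      (discretize n (u n)) (discretize n (u (Suc n)))" for n
  proof -
    obtain N where N: "\<forall>m\<ge>N. eps m < \<delta> n / 4" using dom.eps_small[of "\<delta> n / 4"] \<delta>[of n] by auto
    obtain M where "\<forall>m\<ge>M. homotopic_with (\<lambda>_. True) (dom.stage m) (cod.stage n)
        (discretize n (u n)) (discretize n (u (Suc n)))"
      using homotopic_discretize[OF discrete_homotopic_mono[OF u]] cod.eps_pos[of n] by fastforce
    then show ?thesis using N by (intro exI[of _ "max N M"]) auto
  qed
  then obtain s where s: "\<And>n m. s n \<le> m \<Longrightarrow> 4 * eps m < \<delta> n \<and> homotopic_with (\<lambda>_. True)
      (dom.stage m) (cod.stage n) (discretize n (u n)) (discretize n (u (Suc n)))"
    by metis
  \<comment> \<open>Partial sums make the index function monotone and keep it above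
    \<open>s n\<close>, where the modulus and the homotopies of level n are available.\<close>
  define f where "f n = (\<Sum>i\<le>n. s i)" for n
  have f: "s n \<le> f n" "f n \<le> f (Suc n)" for n by (auto simp: f_def intro: member_le_sum)
  have "mono f" using f(2) by (simp add: mono_iff_le_Suc)
  have mod: "\<forall>x\<in>X. \<forall>y\<in>X. d x y < 4 * eps (f n) \<longrightarrow> l (u n x) (u n y) < eta n" for n
    using s[OF f(1)[of n]] close[of n] by (meson less_trans)
  let ?F = "(f, \<lambda>n. discretize n (u n))"
  have "?F \<in> reps"
    unfolding pro_reps_def
  proof (simp add: \<open>mono f\<close>, intro conjI allI)
    fix n
    show "continuous_map (dom.stage (f n)) (cod.stage n) (discretize n (u n))"
      using s[OF f(1)[of n]] homotopic_with_imp_continuous_maps by blast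
    have mod': "\<forall>x\<in>X. \<forall>y\<in>X. d x y < 4 * eps (f (Suc n)) \<longrightarrow> l (u (Suc n) x) (u (Suc n) y) < eta n"
      using mod[of "Suc n"] cod.eps_antimono[of n "Suc n"] by fastforce
    have mod2: "\<forall>x\<in>X. \<forall>y\<in>X. d x y < 4 * eps (f n) \<longrightarrow> l (u n x) (u n y) < 2 * eta n"
      using mod[of n] cod.eps_pos[of n] by fastforce
    have "homotopic_with (\<lambda>_. True) (dom.stage (f (Suc n))) (cod.stage n)
        (discretize n (u (Suc n))) (discretize n (u n))"
      using s[OF order_trans[OF f(1) f(2)], of n] homotopic_with_symD by blast
    then show "homotopic_with (\<lambda>_. True) (dom.stage (f (Suc n))) (cod.stage n)
        (cod.bonding n \<circ> discretize (Suc n) (u (Suc n)))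
        (discretize n (u n) \<circ> bonds dom.bonding (f n) (f (Suc n)))"
      by (rule homotopic_with_trans[OF homotopic_with_trans[OF
              homotopic_bonding_discretize[OF uY mod']] homotopic_discretize_bonds[OF uY mod2 f(2)]])
  qed
  moreover have "(select_sequence ?F, u) \<in> discrete_equiv"
  proof (rule discrete_equivI)
    show "u \<in> discrete_sequences" using uv by (simp add: discrete_equiv_def)
    fix e :: real assume "e > 0"
    then obtain N where N: "\<forall>n\<ge>N. eta n < e / 4" using cod.eps_small[of "e / 4"] by auto
    have "discrete_homotopic e (select_sequence ?F n) (u n)" if "N \<le> n" for n
      unfolding select_sequence_def fst_conv snd_conv
      by (rule discrete_homotopic_mono[OF contiguous_imp_discrete_homotopic[OF
              contiguous_select_discretize[OF uY mod]]]) (use N that in fastforce)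
    then show "\<exists>N. \<forall>n\<ge>N. discrete_homotopic e (select_sequence ?F n) (u n)" by blast
  qed
  then have "(select_sequence ?F, v) \<in> discrete_equiv"
    using uv equiv_discrete_equiv by (meson equiv_def transD)
  ultimately show ?thesis by blast
qed

proposition pro_morphisms_eqpoll:
  "pro_morphisms dom.stage dom.bonding cod.stage cod.bonding \<approx> discrete_sequences // discrete_equiv"
  unfolding pro_morphisms_def
proof (rule eqpoll_quotient[of _ _ _ _ select_sequence, OF equiv_discrete_equiv])
  show "reps_equiv \<subseteq> reps \<times> reps" by (auto simp: pro_equiv_def)
  show "select_sequence F \<in> discrete_sequences" if "F \<in> reps" for F
    using select_sequence_in that by (cases F) auto
  show "(F, G) \<in> reps_equiv \<longleftrightarrow> (select_sequence F, select_sequence G) \<in> discrete_equiv"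
    if "F \<in> reps" "G \<in> reps" for F G
    using select_sequence_equiv select_sequence_equiv_imp that by (cases F; cases G) blast
qed (rule select_sequence_surj)

end

section \<open>Shape morphisms as discrete homotopy classes\<close>

definition cube :: "(nat \<Rightarrow> real) set" where
  "cube = {x. \<forall>i. 0 \<le> x i \<and> x i \<le> 1}"

lemma hilbert_cube_eq: "hilbert_cube = top_of_set cube"
  by (simp add: hilbert_cube_def cube_def euclidean_product_topology)

text \<open>On the cube the truncation in the product metric is void, so the metric is convex.\<close>

lemma dist_convex_combination_le:
  assumes J: "finite J" and w: "\<And>j. j \<in> J \<Longrightarrow> 0 \<le> w j" "sum w J = 1"
    and z: "z \<in> cube" and p: "\<And>j. j \<in> J \<Longrightarrow> p j \<in> cube"
  shows "dist z (\<lambda>i. \<Sum>j\<in>J. w j * p j i) \<le> (\<Sum>j\<in>J. w j * dist z (p j))"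
proof -
  let ?m = "\<lambda>x n. min (dist (z (from_nat n)) (x (from_nat n))) 1 :: real"
  let ?c = "\<lambda>i. \<Sum>j\<in>J. w j * p j i"
  have sm: "summable (\<lambda>n. (1/2)^n * ?m x n)" for x :: "nat \<Rightarrow> real"
    by (rule summable_comparison_test'[of "\<lambda>n. (1/2)^n" 0]) (auto simp: summable_geometric_iff)
  have le: "?m ?c n \<le> (\<Sum>j\<in>J. w j * ?m (p j) n)" for n
  proof -
    let ?i = "from_nat n :: nat"
    have "z ?i - ?c ?i = (\<Sum>j\<in>J. w j * (z ?i - p j ?i))"
      using w(2) by (simp add: right_diff_distrib sum_subtractf flip: sum_distrib_right)
    also have "\<bar>\<dots>\<bar> \<le> (\<Sum>j\<in>J. w j * \<bar>z ?i - p j ?i\<bar>)"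
      by (rule order_trans[OF sum_abs]) (simp add: abs_mult w(1))
    also have "\<dots> = (\<Sum>j\<in>J. w j * ?m (p j) n)"
    proof (rule sum.cong[OF refl])
      fix j assume "j \<in> J"
      then have "0 \<le> p j ?i" "p j ?i \<le> 1" "0 \<le> z ?i" "z ?i \<le> 1" using p z by (auto simp: cube_def)
      then have "\<bar>z ?i - p j ?i\<bar> \<le> 1" by linarith
      then show "w j * \<bar>z ?i - p j ?i\<bar> = w j * ?m (p j) n" by (simp add: dist_real_def)
    qed
    finally show ?thesis by (simp add: dist_real_def)
  qed
  have "dist z ?c = (\<Sum>n. (1/2)^n * ?m ?c n)" by (simp add: dist_fun_def)
  also have "\<dots> \<le> (\<Sum>n. \<Sum>j\<in>J. w j * ((1/2)^n * ?m (p j) n))"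
  proof (rule suminf_le[OF _ sm])
    show "summable (\<lambda>n. \<Sum>j\<in>J. w j * ((1/2)^n * ?m (p j) n))"
      by (intro summable_sum summable_mult sm)
    fix n
    have "(1/2)^n * ?m ?c n \<le> (1/2)^n * (\<Sum>j\<in>J. w j * ?m (p j) n)" using le by (intro mult_left_mono) auto
    then show "(1/2)^n * ?m ?c n \<le> (\<Sum>j\<in>J. w j * ((1/2)^n * ?m (p j) n))"
      by (simp add: sum_distrib_left mult.left_commute)
  qed
  also have "\<dots> = (\<Sum>j\<in>J. w j * dist z (p j))"
    by (subst suminf_sum) (simp_all add: summable_mult sm suminf_mult dist_fun_def)
  finally show ?thesis .
qed

text \<open>Only points of positive weight have to be close, which suits bump functions; strictness
  survives because some weight is positive.\<close>

lemma dist_convex_combination_less: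
  assumes J: "finite J" and w: "\<And>j. j \<in> J \<Longrightarrow> 0 \<le> w j" "sum w J = 1"
    and z: "z \<in> cube" and p: "\<And>j. j \<in> J \<Longrightarrow> p j \<in> cube"
    and e: "\<And>j. j \<in> J \<Longrightarrow> 0 < w j \<Longrightarrow> dist z (p j) < e"
  shows "dist z (\<lambda>i. \<Sum>j\<in>J. w j * p j i) < e"
proof -
  have le: "w j * dist z (p j) \<le> w j * e" if "j \<in> J" for j
    using w(1)[OF that] e[OF that] by (cases "w j = 0") auto
  have "\<exists>j\<in>J. w j > 0"
    using w sum_nonpos[of J w] by (metis not_less zero_less_one)
  then have "\<exists>j\<in>J. w j * dist z (p j) < w j * e" using e mult_strict_left_mono by blast
  then have "(\<Sum>j\<in>J. w j * dist z (p j)) < (\<Sum>j\<in>J. w j * e)"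
    using J le by (intro sum_strict_mono_ex1) auto
  also have "\<dots> = e" using w(2) by (simp flip: sum_distrib_right)
  finally show ?thesis using dist_convex_combination_le[of J w z p, OF J w z p] by simp
qed

lemma convex_combination_in_cube:
  assumes "finite J" "\<And>j. j \<in> J \<Longrightarrow> 0 \<le> w j" "sum w J = 1" "\<And>j. j \<in> J \<Longrightarrow> p j \<in> cube"
  shows "(\<lambda>i. \<Sum>j\<in>J. w j * p j i) \<in> cube"
proof -
  have "0 \<le> (\<Sum>j\<in>J. w j * p j i)" for i using assms by (intro sum_nonneg) (auto simp: cube_def)
  moreover have "(\<Sum>j\<in>J. w j * p j i) \<le> (\<Sum>j\<in>J. w j)" for i
    using assms by (intro sum_mono) (auto simp: cube_def mult_left_le)
  ultimately show ?thesis using assms(3) by (simp add: cube_def)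
qed

definition mix :: "real \<Rightarrow> (nat \<Rightarrow> real) \<Rightarrow> (nat \<Rightarrow> real) \<Rightarrow> nat \<Rightarrow> real" where
  "mix t x y = (\<lambda>i. (1 - t) * x i + t * y i)"

text \<open>A segment is a convex combination indexed by \<open>bool\<close>, so the general
  estimates apply to it.\<close>

lemma mix_sum: "mix t x y = (\<lambda>i. \<Sum>b\<in>UNIV. (if b then t else 1 - t) * (if b then y else x) i)"
  by (simp add: mix_def UNIV_bool)

lemma mix_0 [simp]: "mix 0 x y = x" and mix_1 [simp]: "mix 1 x y = y"
  by (simp_all add: mix_def)

lemma mix_in_cube: "x \<in> cube \<Longrightarrow> y \<in> cube \<Longrightarrow> 0 \<le> t \<Longrightarrow> t \<le> 1 \<Longrightarrow> mix t x y \<in> cube"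
  unfolding mix_sum by (rule convex_combination_in_cube) (auto simp: UNIV_bool)

lemma dist_mix_less:
  "z \<in> cube \<Longrightarrow> x \<in> cube \<Longrightarrow> y \<in> cube \<Longrightarrow> 0 \<le> t \<Longrightarrow> t \<le> 1 \<Longrightarrow> dist z x < e \<Longrightarrow> dist z y < e
    \<Longrightarrow> dist z (mix t x y) < e"
  unfolding mix_sum by (rule dist_convex_combination_less) (auto simp: UNIV_bool)

lemma continuous_on_mix:
  assumes "continuous_on S t" "continuous_on S f" "continuous_on S g"
  shows "continuous_on S (\<lambda>x. mix (t x) (f x) (g x))"
  unfolding mix_def
  by (intro continuous_intros assms continuous_on_product_then_coordinatewise[OF assms(2)]
      continuous_on_product_then_coordinatewise[OF assms(3)])

text \<open>The approximation is glued with a partition of unity. Enlarging the radius \<open>\<delta>\<close> of its bump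
  functions by \<open>infdist x X\<close> changes nothing on \<open>X\<close> and keeps their sum positive on the whole cube.\<close>

lemma continuous_approximation:
  assumes X: "compact X" and p: "p \<in> X \<rightarrow> cube"
    and \<delta>: "\<delta> > 0" "\<forall>x\<in>X. \<forall>y\<in>X. dist x y < \<delta> \<longrightarrow> dist (p x) (p y) < e"
  obtains F :: "(nat \<Rightarrow> real) \<Rightarrow> nat \<Rightarrow> real"
    where "continuous_on cube F" "F \<in> cube \<rightarrow> cube" "\<forall>x\<in>X. dist (F x) (p x) < e"
proof (cases "X = {}")
  case True
  then show ?thesis using that[of "\<lambda>x. x"] by simp
next
  case False
  \<comment> \<open>One half of \<delta> pays for an almost nearest point of X, the other half for a
    net point near that one; hence some bump function is positive at every x.\<close>
  obtain K where K: "finite K" "K \<subseteq> X" "X \<subseteq> (\<Union>a\<in>K. ball a (\<delta>/2))"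
    using compactE_image[OF X, of X "\<lambda>a. ball a (\<delta>/2)"] \<delta>(1) by force
  define w where "w a x = max 0 (infdist x X + \<delta> - dist x a)" for a x
  define F where "F x = (\<lambda>i. \<Sum>a\<in>K. (w a x / (\<Sum>b\<in>K. w b x)) * p a i)" for x
  have w0: "0 \<le> w a x" for a x by (simp add: w_def)
  have pos: "0 < (\<Sum>b\<in>K. w b x)" for x
  proof -
    have "\<exists>y\<in>X. dist x y < infdist x X + \<delta>/2"
      using False \<delta>(1) unfolding infdist_def by (simp add: cINF_less_iff[of X "dist x", symmetric])
    then obtain y where y: "y \<in> X" "dist x y < infdist x X + \<delta>/2" by blast
    then obtain a where a: "a \<in> K" "dist a y < \<delta>/2" using K by auto
    have "dist x a \<le> dist x y + dist a y" by (metis dist_commute dist_triangle)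
    then have "0 < w a x" using a y by (simp add: w_def)
    then show ?thesis using K(1) a w0 by (intro sum_pos2[of K a]) auto
  qed
  have W: "\<And>a. a \<in> K \<Longrightarrow> 0 \<le> w a x / (\<Sum>b\<in>K. w b x)" "(\<Sum>a\<in>K. w a x / (\<Sum>b\<in>K. w b x)) = 1" for x
    using w0 pos[of x] by (auto simp flip: sum_divide_distrib)
  have pK: "p a \<in> cube" if "a \<in> K" for a using that K p by auto
  show ?thesis
  proof (rule that[of F])
    have "continuous_on cube (w a)" for a
      unfolding w_def by (intro continuous_intros)
    then show "continuous_on cube F"
      unfolding F_def using pos by (intro continuous_intros) (auto simp: less_imp_neq[symmetric])
    show "F \<in> cube \<rightarrow> cube"
      unfolding F_def by (intro funcsetI convex_combination_in_cube K(1) W pK)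
    show "\<forall>x\<in>X. dist (F x) (p x) < e"
    proof
      fix x assume x: "x \<in> X"
      have "dist (p x) (F x) < e"
        unfolding F_def
      proof (rule dist_convex_combination_less[OF K(1) W _ pK])
        show "p x \<in> cube" using p x by blast
        fix a assume a: "a \<in> K" "0 < w a x / (\<Sum>b\<in>K. w b x)"
        then have "0 < w a x" using pos[of x] by (simp add: zero_less_divide_iff)
        then have "dist x a < \<delta>" using x by (simp add: w_def less_max_iff_disj)
        then show "dist (p x) (p a) < e" using \<delta>(2) x a K(2) by blast
      qed
      then show "dist (F x) (p x) < e" by (simp add: dist_commute)
    qed
  qed
qed

section \<open>Neighbourhoods of Y and nearest points\<close>

locale cube_pair =
  fixes X Y :: "(nat \<Rightarrow> real) set"
  assumes X: "compact X" "X \<subseteq> cube" and Y: "compact Y" "Y \<subseteq> cube"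
begin

sublocale metric_pair X dist Y dist
  by (simp add: metric_pair_def Met_TC.subspace)

definition nbhd :: "real \<Rightarrow> (nat \<Rightarrow> real) set" where
  "nbhd e = {q \<in> cube. \<exists>y\<in>Y. dist q y < e}"

definition nearest :: "(nat \<Rightarrow> real) \<Rightarrow> nat \<Rightarrow> real" where
  "nearest q = (SOME y. y \<in> Y \<and> (\<forall>z\<in>Y. dist q y \<le> dist q z))"

lemma nearest:
  assumes "y \<in> Y" "dist q y < e"
  shows "nearest q \<in> Y" "dist q (nearest q) < e"
proof -
  have "\<exists>y\<in>Y. \<forall>z\<in>Y. dist q y \<le> dist q z"
    using Y(1) assms(1) by (intro continuous_attains_inf continuous_intros) auto
  then have *: "nearest q \<in> Y \<and> (\<forall>z\<in>Y. dist q (nearest q) \<le> dist q z)"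
    unfolding nearest_def by (intro someI_ex[of "\<lambda>y. y \<in> Y \<and> (\<forall>z\<in>Y. dist q y \<le> dist q z)"]) blast
  then show "nearest q \<in> Y" "dist q (nearest q) < e"
    using assms by (auto intro: le_less_trans)
qed

lemma openin_nbhd: "openin hilbert_cube (nbhd e)"
proof -
  have "nbhd e = cube \<inter> (\<Union>y\<in>Y. ball y e)" by (auto simp: nbhd_def dist_commute)
  then show ?thesis unfolding hilbert_cube_eq by auto
qed

lemma Y_subset_nbhd: "e > 0 \<Longrightarrow> Y \<subseteq> nbhd e"
proof
  show "y \<in> nbhd e" if "e > 0" "y \<in> Y" for y
    using that Y(2) by (auto simp: nbhd_def intro!: bexI[of _ y])
qed

lemma nbhd_mono: "e \<le> e' \<Longrightarrow> nbhd e \<subseteq> nbhd e'"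
  by (auto simp: nbhd_def intro: less_le_trans)

text \<open>Compactness of Y makes the metric neighbourhoods cofinal among all open neighbourhoods
  of Y, so those in the definition of a fundamental sequence may be replaced by numbers e.\<close>

lemma openin_contains_nbhd:
  assumes "openin hilbert_cube V" "Y \<subseteq> V"
  obtains e where "e > 0" "nbhd e \<subseteq> V"
proof -
  obtain T where T: "open T" "V = cube \<inter> T" using assms(1) by (auto simp: hilbert_cube_eq openin_open)
  then obtain e where "e > 0" "(\<Union>y\<in>Y. ball y e) \<subseteq> T"
    using compact_subset_open_imp_ball_epsilon_subset[OF Y(1), of T] assms(2) by blast
  then show thesis using that[of e] T by (force simp: nbhd_def dist_commute)
qed

text \<open>The homotopy is uniformly continuous on the compact set
  \<open>{0..1} \<times> X\<close>, so nearby times give contiguous functions. Of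
  \<open>3 * e\<close>, two parts go to the two nearest points and one to the oscillation of
  h.\<close>

lemma discrete_homotopic_nearest:
  assumes FG: "homotopic_with_canon (\<lambda>_. True) U (nbhd e) F G" and U: "X \<subseteq> U"
  shows "discrete_homotopic (3 * e) (\<lambda>x. nearest (F x)) (\<lambda>x. nearest (G x))"
proof -
  obtain h where h: "continuous_on ({0..1::real} \<times> X) h" "h \<in> {0..1} \<times> X \<rightarrow> nbhd e"
    and h01: "\<forall>x. h (0, x) = F x" "\<forall>x. h (1, x) = G x"
    using homotopic_with_subset_left[OF FG U] unfolding homotopic_with_def by auto
  let ?R = "\<lambda>s t. discrete_homotopic (3 * e) (\<lambda>x. nearest (h (s, x))) (\<lambda>x. nearest (h (t, x)))"
  have near: "nearest (h (t, x)) \<in> Y \<and> dist (h (t, x)) (nearest (h (t, x))) < e"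
    if "t \<in> {0..1}" "x \<in> X" for t x
  proof -
    have "h (t, x) \<in> nbhd e" using h(2) that by auto
    then show ?thesis using nearest by (auto simp: nbhd_def)
  qed
  have "?R 0 1"
  proof (rule connected_equivalence_relation[of "{0..1::real}" 0 1 ?R])
    fix t :: real assume t: "t \<in> {0..1}"
    show "\<exists>T. openin (top_of_set {0..1}) T \<and> t \<in> T \<and> (\<forall>s\<in>T. ?R t s)"
    \<comment> \<open>Positivity of e is read off from a point of X, which is within e of its
      nearest point; for empty X contiguity is vacuous.\<close>
    proof (cases "X = {}")
      case True
      then have "?R t s" for s
        by (intro contiguous_imp_discrete_homotopic contiguousI[of _ _ 1]) auto
      then show ?thesis using t openin_subtopology_self by blast
    next
      case False
      then have e: "e > 0" using near[OF t] by (metis dist_not_less_zero equals0I le_less_trans linorder_not_less)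
      have "uniformly_continuous_on ({0..1} \<times> X) h"
        using h(1) X(1) by (intro compact_uniformly_continuous compact_Times) auto
      then obtain \<delta> where \<delta>: "\<delta> > 0" "\<forall>a\<in>{0..1} \<times> X. \<forall>b\<in>{0..1} \<times> X. dist b a < \<delta> \<longrightarrow> dist (h b) (h a) < e"
        using e unfolding uniformly_continuous_on_def by meson
      have "?R t s" if s: "s \<in> {0..1} \<inter> ball t (\<delta>/2)" for s
      proof (rule contiguous_imp_discrete_homotopic, rule contiguousI[of _ _ "\<delta>/2"])
        fix x y assume xy: "x \<in> X" "y \<in> X" "dist x y < \<delta>/2"
        have close: "dist (nearest (h (a, x))) (nearest (h (b, y))) < 3 * e"
          if ab: "a \<in> {0..1}" "b \<in> {0..1}" "dist a b < \<delta>/2" for a b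
        proof -
          have "dist (a, x) (b, y) \<le> dist a b + dist x y"
            unfolding dist_Pair_Pair by (rule sqrt_sum_squares_le_sum) auto
          then have "dist (a, x) (b, y) < \<delta>" using ab(3) xy(3) by linarith
          then have "dist (h (a, x)) (h (b, y)) < e" using \<delta>(2) ab xy by simp
          moreover have "dist (nearest (h (a, x))) (nearest (h (b, y))) \<le>
              dist (h (a, x)) (nearest (h (a, x))) + dist (h (a, x)) (h (b, y)) + dist (h (b, y)) (nearest (h (b, y)))"
            using dist_triangle[of "nearest (h (a, x))" "nearest (h (b, y))" "h (a, x)"]
              dist_triangle[of "h (a, x)" "nearest (h (b, y))" "h (b, y)"]
            by (simp add: dist_commute)
          ultimately show ?thesis using near[OF ab(1) xy(1)] near[OF ab(2) xy(2)] by linarith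
        qed
        show "dist (nearest (h (t, x))) (nearest (h (t, y))) < 3 * e \<and>
            dist (nearest (h (s, x))) (nearest (h (s, y))) < 3 * e \<and>
            dist (nearest (h (t, x))) (nearest (h (s, y))) < 3 * e"
          using close[of t t] close[of s s] close[of t s] s t \<delta>(1) by simp
      qed (use near s t \<delta> in auto)
      moreover have "openin (top_of_set {0..1}) ({0..1} \<inter> ball t (\<delta>/2))" by auto
      ultimately show ?thesis using t \<delta>(1) by (intro exI[of _ "{0..1} \<inter> ball t (\<delta>/2)"]) auto
    qed
  next
    show "?R u w" if "?R u v" "?R v w" for u v w using that by (rule discrete_homotopic_trans)
    show "?R v u" if "?R u v" for u v using that by (rule discrete_homotopic_sym)
  qed simp_all
  then show ?thesis using h01 by simp
qed

section \<open>Straight-line homotopies near Y\<close>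

definition near_on_X :: "real \<Rightarrow> ((nat \<Rightarrow> real) \<Rightarrow> nat \<Rightarrow> real) \<Rightarrow> ((nat \<Rightarrow> real) \<Rightarrow> nat \<Rightarrow> real) \<Rightarrow> bool" where
  "near_on_X e F u \<longleftrightarrow> continuous_on cube F \<and> F \<in> cube \<rightarrow> cube \<and> (\<forall>x\<in>X. dist (F x) (u x) < e)"

text \<open>The homotopies in this relation do not shrink the domain: this makes it possible to
  concatenate infinitely many of them over a fixed neighbourhood of \<open>X\<close>.\<close>

definition homotopic_near :: "real \<Rightarrow> ((nat \<Rightarrow> real) \<Rightarrow> nat \<Rightarrow> real) \<Rightarrow> ((nat \<Rightarrow> real) \<Rightarrow> nat \<Rightarrow> real) \<Rightarrow> bool" where
  "homotopic_near e F G \<longleftrightarrow> (\<forall>U V. U \<subseteq> cube \<longrightarrow> F \<in> U \<rightarrow> V \<longrightarrow> nbhd e \<subseteq> V \<longrightarrow>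
     homotopic_with_canon (\<lambda>_. True) U V F G)"

lemma homotopic_near_trans:
  assumes "homotopic_near e F G" "homotopic_near e G H"
  shows "homotopic_near e F H"
  unfolding homotopic_near_def
proof (intro allI impI)
  fix U V assume UV: "U \<subseteq> cube" "F \<in> U \<rightarrow> V" "nbhd e \<subseteq> V"
  then have FG: "homotopic_with_canon (\<lambda>_. True) U V F G" using assms(1) unfolding homotopic_near_def by blast
  have "G \<in> U \<rightarrow> V" using homotopic_with_imp_funspace2[OF FG] .
  then have "homotopic_with_canon (\<lambda>_. True) U V G H" using assms(2) UV unfolding homotopic_near_def by blast
  with FG show "homotopic_with_canon (\<lambda>_. True) U V F H" by (rule homotopic_with_trans)
qed

text \<open>A single y has to be close to both values: by convexity the whole segment between them
  then stays close to that y.\<close>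

lemma openin_both_near:
  assumes "continuous_on cube F" "continuous_on cube G"
  shows "openin hilbert_cube {x \<in> cube. \<exists>y\<in>Y. dist (F x) y < e \<and> dist (G x) y < e}"
proof -
  have "{x \<in> cube. \<exists>y\<in>Y. dist (F x) y < e \<and> dist (G x) y < e}
      = (\<Union>y\<in>Y. (cube \<inter> F -` ball y e) \<inter> (cube \<inter> G -` ball y e))"
    by (auto simp: dist_commute)
  moreover have "openin (top_of_set cube) \<dots>"
    by (intro openin_Union ballI; clarify?; intro openin_Int continuous_openin_preimage_gen assms open_ball)
  ultimately show ?thesis by (simp add: hilbert_cube_eq)
qed

lemma mix_in_nbhd:
  assumes "y \<in> Y" "x \<in> cube" "x' \<in> cube" "dist x y < e" "dist x' y < e" "0 \<le> t" "t \<le> 1"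
  shows "mix t x x' \<in> nbhd e"
  using assms Y(2) dist_mix_less[of y x x' t e] mix_in_cube[of x x' t]
  by (auto simp: nbhd_def dist_commute)

text \<open>The straight-line homotopy from \<open>F\<close> to \<open>G\<^sub>0\<close> is damped by a bump function around \<open>X\<close>, so
  that it is stationary at the points where the line may leave the neighbourhood of \<open>Y\<close>.\<close>

lemma homotopic_near_extension_step:
  assumes F: "near_on_X e F u" and G0: "near_on_X e G0 u'"
    and u: "u \<in> X \<rightarrow> Y" "\<forall>x\<in>X. dist (u x) (u' x) < e"
  shows "\<exists>G. continuous_on cube G \<and> G \<in> cube \<rightarrow> cube \<and> (\<forall>x\<in>X. G x = G0 x) \<and> homotopic_near (2 * e) F G"
proof (cases "X = {}")
  case True
  then show ?thesis using F unfolding near_on_X_def homotopic_near_def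
    by (intro exI[of _ F]) (auto simp: Pi_iff intro: continuous_on_subset)
next
  case False
  have cF: "continuous_on cube F" "F \<in> cube \<rightarrow> cube" and cG: "continuous_on cube G0" "G0 \<in> cube \<rightarrow> cube"
    using F G0 by (auto simp: near_on_X_def)
  \<comment> \<open>The factor 2 is due to G0: on X it is within e of u', and u' is within e of u,
    so \<open>u x\<close> serves as y for both maps.\<close>
  define W where "W = {x \<in> cube. \<exists>y\<in>Y. dist (F x) y < 2 * e \<and> dist (G0 x) y < 2 * e}"
  have "openin hilbert_cube W" unfolding W_def by (rule openin_both_near[OF cF(1) cG(1)])
  then obtain T where T: "open T" "W = cube \<inter> T" by (auto simp: hilbert_cube_eq openin_open)
  have "X \<subseteq> W"
  proof
    fix x assume x: "x \<in> X"
    then have close: "dist (F x) (u x) < e" "dist (G0 x) (u' x) < e" "dist (u x) (u' x) < e"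
      using F G0 u by (auto simp: near_on_X_def)
    have "dist (G0 x) (u x) \<le> dist (G0 x) (u' x) + dist (u x) (u' x)"
      by (metis dist_commute dist_triangle)
    moreover have "e > 0" using close(1) by (meson le_less_trans zero_le_dist)
    ultimately show "x \<in> W" using x X(2) u(1) close unfolding W_def by (auto intro!: bexI[of _ "u x"])
  qed
  then obtain \<eta> where \<eta>: "\<eta> > 0" "(\<Union>x\<in>X. ball x \<eta>) \<subseteq> T"
    using compact_subset_open_imp_ball_epsilon_subset[OF X(1) T(1)] T(2) by blast
  define \<phi> where "\<phi> x = max 0 (1 - infdist x X / \<eta>)" for x
  have \<phi>: "0 \<le> \<phi> x" "\<phi> x \<le> 1" for x using \<eta>(1) by (auto simp: \<phi>_def infdist_nonneg)
  have \<phi>1: "\<phi> x = 1" if "x \<in> X" for x using that by (simp add: \<phi>_def)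
  have c\<phi>: "continuous_on S \<phi>" for S unfolding \<phi>_def using \<eta>(1) by (intro continuous_intros) auto
  have \<phi>W: "x \<in> W" if x: "x \<in> cube" "\<phi> x \<noteq> 0" for x
  proof -
    have "1 - infdist x X / \<eta> > 0" using x(2) unfolding \<phi>_def by linarith
    then have "infdist x X < \<eta>" using \<eta>(1) by (simp add: field_simps)
    then have "\<exists>a\<in>X. dist x a < \<eta>"
      using False unfolding infdist_def by (simp add: cINF_less_iff)
    then have "x \<in> (\<Union>a\<in>X. ball a \<eta>)" by (simp add: dist_commute)
    then show ?thesis using \<eta>(2) T(2) x(1) by blast
  qed
  define G where "G x = mix (\<phi> x) (F x) (G0 x)" for x
  have "homotopic_with_canon (\<lambda>_. True) U V F G" if UV: "U \<subseteq> cube" "F \<in> U \<rightarrow> V" "nbhd (2 * e) \<subseteq> V" for U V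
  proof -
    let ?h = "\<lambda>a. mix (fst a * \<phi> (snd a)) (F (snd a)) (G0 (snd a))"
    have cont: "continuous_on ({0..1} \<times> U) (\<lambda>a. f (snd a))" if "continuous_on cube f"
      for f :: "(nat \<Rightarrow> real) \<Rightarrow> 'z::topological_space"
      using UV(1) by (intro continuous_on_compose2[OF that continuous_on_snd[OF continuous_on_id]]) auto
    have "continuous_on ({0..1::real} \<times> U) ?h"
      by (intro continuous_on_mix continuous_on_mult continuous_on_fst continuous_on_id cont cF cG c\<phi>)
    moreover have "?h a \<in> V" if "a \<in> {0..1} \<times> U" for a
    proof (cases "\<phi> (snd a) = 0")
      case True
      then show ?thesis using that UV(2) by auto
    next
      case False
      have a: "snd a \<in> U" "snd a \<in> cube" "0 \<le> fst a" "fst a \<le> 1" using that UV(1) by auto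
      obtain y where y: "y \<in> Y" "dist (F (snd a)) y < 2 * e" "dist (G0 (snd a)) y < 2 * e"
        using \<phi>W[OF a(2) False] unfolding W_def by blast
      have "?h a \<in> nbhd (2 * e)"
        using y a \<phi>[of "snd a"] cF(2) cG(2)
        by (intro mix_in_nbhd[of y]) (auto intro: mult_le_one)
      then show ?thesis using UV(3) by blast
    qed
    ultimately show ?thesis
      unfolding homotopic_with_def G_def by (intro exI[of _ ?h]) (auto simp: prod_topology_subtopology_eu)
  qed
  then have "homotopic_near (2 * e) F G" by (simp add: homotopic_near_def)
  moreover have "continuous_on cube G" unfolding G_def by (intro continuous_on_mix c\<phi> cF cG)
  moreover have "G \<in> cube \<rightarrow> cube" unfolding G_def using cF(2) cG(2) \<phi> by (auto intro!: mix_in_cube)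
  moreover have "\<forall>x\<in>X. G x = G0 x" using \<phi>1 by (simp add: G_def)
  ultimately show ?thesis by blast
qed

lemma discrete_homotopic_near:
  assumes "discrete_homotopic e u v"
  obtains F where "near_on_X e F v" "v \<in> X \<rightarrow> Y"
proof -
  obtain w where "contiguous e v w"
    using discrete_homotopic_sym[OF assms] unfolding discrete_homotopic_def by (rule converse_tranclpE) blast+
  then obtain \<delta> where v: "v \<in> X \<rightarrow> Y" and \<delta>: "\<delta> > 0" "\<forall>x\<in>X. \<forall>y\<in>X. dist x y < \<delta> \<longrightarrow> dist (v x) (v y) < e"
    unfolding contiguous_def by blast
  have "v \<in> X \<rightarrow> cube" using v Y(2) by blast
  then obtain F where "continuous_on cube F" "F \<in> cube \<rightarrow> cube" "\<forall>x\<in>X. dist (F x) (v x) < e"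
    using continuous_approximation[OF X(1) _ \<delta>] by blast
  then show thesis using that v by (simp add: near_on_X_def)
qed

lemma contiguous_pointwise:
  assumes "contiguous e u v"
  shows "u \<in> X \<rightarrow> Y" "\<forall>x\<in>X. dist (u x) (v x) < e"
  using assms unfolding contiguous_def by (blast, metis dist_self)

text \<open>Each intermediate function of the chain receives a fresh continuous approximation with
  error e, corrected only off X; the error therefore stays at \<open>2 * e\<close> however long the
  chain is.\<close>

lemma homotopic_near_extension:
  assumes uv: "discrete_homotopic e u v" and F: "near_on_X e F u" and G0: "near_on_X e G0 v"
  shows "\<exists>G. continuous_on cube G \<and> G \<in> cube \<rightarrow> cube \<and> (\<forall>x\<in>X. G x = G0 x) \<and> homotopic_near (2 * e) F G"
  using uv G0 unfolding discrete_homotopic_def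
proof (induction arbitrary: G0)
  case (base v)
  show ?case
    by (rule homotopic_near_extension_step[OF F base(2) contiguous_pointwise[OF base(1)]])
next
  case (step v w)
  have "discrete_homotopic e u v" using step(1) by (simp add: discrete_homotopic_def)
  then obtain H0 where "near_on_X e H0 v" by (rule discrete_homotopic_near)
  with step(3) obtain H where H: "near_on_X e H v" "homotopic_near (2 * e) F H"
    unfolding near_on_X_def by (metis (no_types, lifting))
  obtain G where G: "continuous_on cube G" "G \<in> cube \<rightarrow> cube" "\<forall>x\<in>X. G x = G0 x" "homotopic_near (2 * e) H G"
    using homotopic_near_extension_step[OF H(1) step(4) contiguous_pointwise[OF step(2)]] by blast
  then show ?case using homotopic_near_trans[OF H(2) G(4)] by blast
qed

text \<open>Here the domain U depends on F and G, so this is suited to comparing one pair of maps,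
  not infinitely many.\<close>

lemma homotopic_if_near:
  assumes F: "near_on_X e F u" and G: "near_on_X e G u" and u: "u \<in> X \<rightarrow> Y"
  obtains U where "openin hilbert_cube U" "X \<subseteq> U" "homotopic_with_canon (\<lambda>_. True) U (nbhd e) F G"
proof -
  let ?U = "{x \<in> cube. \<exists>y\<in>Y. dist (F x) y < e \<and> dist (G x) y < e}"
  have cF: "continuous_on cube F" "F \<in> cube \<rightarrow> cube" and cG: "continuous_on cube G" "G \<in> cube \<rightarrow> cube"
    using F G by (auto simp: near_on_X_def)
  show thesis
  proof (rule that)
    show "openin hilbert_cube ?U" by (rule openin_both_near[OF cF(1) cG(1)])
    show "X \<subseteq> ?U" using X(2) u F G by (auto simp: near_on_X_def)
    let ?h = "\<lambda>a. mix (fst a) (F (snd a)) (G (snd a))"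
    have cont: "continuous_on ({0..1} \<times> ?U) (\<lambda>a. f (snd a))" if "continuous_on cube f"
      for f :: "(nat \<Rightarrow> real) \<Rightarrow> nat \<Rightarrow> real"
      by (intro continuous_on_compose2[OF that continuous_on_snd[OF continuous_on_id]]) auto
    have "continuous_on ({0..1::real} \<times> ?U) ?h"
      by (intro continuous_on_mix continuous_on_fst continuous_on_id cont cF cG)
    moreover have "?h a \<in> nbhd e" if a: "a \<in> {0..1} \<times> ?U" for a
    proof -
      obtain y where "y \<in> Y" "dist (F (snd a)) y < e" "dist (G (snd a)) y < e" using a by auto
      then show ?thesis using a cF(2) cG(2) by (intro mix_in_nbhd[of y]) auto
    qed
    ultimately show "homotopic_with_canon (\<lambda>_. True) ?U (nbhd e) F G"
      unfolding homotopic_with_def by (intro exI[of _ ?h]) (auto simp: prod_topology_subtopology_eu)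
  qed
qed

section \<open>Fundamental sequences and discrete sequences\<close>

abbreviation "fund \<equiv> fundamental_sequences X Y"

definition nearest_sequence :: "(nat \<Rightarrow> (nat \<Rightarrow> real) \<Rightarrow> nat \<Rightarrow> real) \<Rightarrow> nat \<Rightarrow> (nat \<Rightarrow> real) \<Rightarrow> nat \<Rightarrow> real" where
  "nearest_sequence fs k = (\<lambda>x. nearest (fs k x))"

lemma hc_eventually_homotopic_iff:
  assumes "openin hilbert_cube U" "openin hilbert_cube V"
  shows "hc_eventually_homotopic U V fs gs \<longleftrightarrow>
    (\<exists>k0. \<forall>k\<ge>k0. homotopic_with_canon (\<lambda>_. True) U V (fs k) (gs k))"
proof -
  have "cube \<inter> U = U" "cube \<inter> V = V"
    using openin_subset[OF assms(1)] openin_subset[OF assms(2)] by (auto simp: hilbert_cube_eq)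
  then show ?thesis unfolding hc_eventually_homotopic_def by (simp add: hilbert_cube_eq subtopology_subtopology)
qed

lemma ex_hc_eventually_homotopic_iff:
  assumes "openin hilbert_cube V"
  shows "(\<exists>U. openin hilbert_cube U \<and> X \<subseteq> U \<and> hc_eventually_homotopic U V fs gs) \<longleftrightarrow>
    (\<exists>U. openin hilbert_cube U \<and> X \<subseteq> U \<and>
      (\<exists>k0. \<forall>k\<ge>k0. homotopic_with_canon (\<lambda>_. True) U V (fs k) (gs k)))"
  by (intro ex_cong1 conj_cong refl hc_eventually_homotopic_iff[OF _ assms])

lemma fund_iff:
  "fs \<in> fund \<longleftrightarrow> (\<forall>k. continuous_on cube (fs k) \<and> fs k \<in> cube \<rightarrow> cube) \<and>
     (\<forall>V. openin hilbert_cube V \<and> Y \<subseteq> V \<longrightarrow> (\<exists>U. openin hilbert_cube U \<and> X \<subseteq> U \<and>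
       (\<exists>k0. \<forall>k\<ge>k0. homotopic_with_canon (\<lambda>_. True) U V (fs k) (fs (Suc k)))))"
  unfolding fundamental_sequences_def mem_Collect_eq
proof (intro conj_cong all_cong1 imp_cong refl, goal_cases)
  case (1 k)
  show ?case by (simp add: hilbert_cube_eq)
next
  case (2 V)
  then show ?case by (intro ex_hc_eventually_homotopic_iff) simp
qed

lemma fundE:
  assumes "fs \<in> fund" "openin hilbert_cube V" "Y \<subseteq> V"
  obtains U k0 where "openin hilbert_cube U" "X \<subseteq> U"
    "\<forall>k\<ge>k0. homotopic_with_canon (\<lambda>_. True) U V (fs k) (fs (Suc k))"
  using conjunct2[OF assms(1)[unfolded fund_iff], THEN spec, of V] assms(2,3) by auto

lemma fs_homotopic_iff:
  "(fs, gs) \<in> fs_homotopic X Y \<longleftrightarrow> fs \<in> fund \<and> gs \<in> fund \<and>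
     (\<forall>V. openin hilbert_cube V \<and> Y \<subseteq> V \<longrightarrow> (\<exists>U. openin hilbert_cube U \<and> X \<subseteq> U \<and>
       (\<exists>k0. \<forall>k\<ge>k0. homotopic_with_canon (\<lambda>_. True) U V (fs k) (gs k))))"
  unfolding fs_homotopic_def mem_Collect_eq prod.case
proof (intro conj_cong all_cong1 imp_cong refl, goal_cases)
  case (1 V)
  then show ?case by (intro ex_hc_eventually_homotopic_iff) simp
qed

lemma eventually_discrete_homotopic_nearest:
  assumes "\<forall>V. openin hilbert_cube V \<and> Y \<subseteq> V \<longrightarrow> (\<exists>U. openin hilbert_cube U \<and> X \<subseteq> U \<and>
       (\<exists>k0. \<forall>k\<ge>k0. homotopic_with_canon (\<lambda>_. True) U V (fs k) (gs k)))" and "e > 0"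
  shows "\<exists>N. \<forall>k\<ge>N. discrete_homotopic e (nearest_sequence fs k) (nearest_sequence gs k)"
proof -
  obtain U k0 where U: "X \<subseteq> U" "\<forall>k\<ge>k0. homotopic_with_canon (\<lambda>_. True) U (nbhd (e/3)) (fs k) (gs k)"
    using assms(1)[THEN spec, of "nbhd (e/3)"] openin_nbhd[of "e/3"] Y_subset_nbhd[of "e/3"] assms(2) by auto
  have "discrete_homotopic (3 * (e/3)) (nearest_sequence fs k) (nearest_sequence gs k)" if "k0 \<le> k" for k
    unfolding nearest_sequence_def by (rule discrete_homotopic_nearest[OF _ U(1)]) (use U(2) that in blast)
  then show ?thesis by auto
qed

lemma nearest_sequence_in: "fs \<in> fund \<Longrightarrow> nearest_sequence fs \<in> discrete_sequences"
  using eventually_discrete_homotopic_nearest[of fs "\<lambda>k. fs (Suc k)"]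
  unfolding fund_iff discrete_sequences_def nearest_sequence_def by simp

lemma fund_eventually_near:
  assumes fs: "fs \<in> fund" and "e > 0"
  shows "\<exists>N. \<forall>k\<ge>N. near_on_X e (fs k) (nearest_sequence fs k) \<and> nearest_sequence fs k \<in> X \<rightarrow> Y"
proof -
  obtain U k0 where U: "X \<subseteq> U" "\<forall>k\<ge>k0. homotopic_with_canon (\<lambda>_. True) U (nbhd e) (fs k) (fs (Suc k))"
    by (rule fundE[OF fs openin_nbhd Y_subset_nbhd[OF \<open>e > 0\<close>]])
  have "near_on_X e (fs k) (nearest_sequence fs k) \<and> nearest_sequence fs k \<in> X \<rightarrow> Y" if k: "k0 \<le> k" for k
  proof -
    have "fs k \<in> U \<rightarrow> nbhd e" using U(2) k homotopic_with_imp_funspace1 by blast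
    then have "\<exists>y\<in>Y. dist (fs k x) y < e" if "x \<in> X" for x using U(1) that by (auto simp: nbhd_def)
    then have "nearest (fs k x) \<in> Y \<and> dist (fs k x) (nearest (fs k x)) < e" if "x \<in> X" for x
      using nearest that by blast
    then show ?thesis using fs unfolding fund_iff near_on_X_def nearest_sequence_def by simp
  qed
  then show ?thesis by blast
qed

lemma homotopic_chain:
  assumes "\<forall>k\<ge>k0. homotopic_with_canon (\<lambda>_. True) U V (fs k) (fs (Suc k))" and "k0 \<le> i" "i \<le> j"
  shows "homotopic_with_canon (\<lambda>_. True) U V (fs i) (fs j)"
  using assms(3)
proof (induction j rule: dec_induct)
  case base
  have "homotopic_with_canon (\<lambda>_. True) U V (fs i) (fs (Suc i))" using assms(1,2) by blast
  then show ?case using homotopic_with_symD homotopic_with_trans by blast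
next
  case (step j)
  have "homotopic_with_canon (\<lambda>_. True) U V (fs j) (fs (Suc j))" using assms(1,2) step(1) by simp
  then show ?case by (rule homotopic_with_trans[OF step(3)])
qed

text \<open>The two sequences are compared at a single index K. For later k the homotopies supplied
  by the fundamental sequences themselves lead back to K, over neighbourhoods independent of
  k.\<close>

lemma nearest_sequence_equiv_imp:
  assumes fs: "fs \<in> fund" and gs: "gs \<in> fund"
    and eq: "(nearest_sequence fs, nearest_sequence gs) \<in> discrete_equiv"
  shows "(fs, gs) \<in> fs_homotopic X Y"
  unfolding fs_homotopic_iff
proof (intro conjI fs gs allI impI; elim conjE)
  fix V assume V: "openin hilbert_cube V" "Y \<subseteq> V"
  obtain e0 where e0: "e0 > 0" "nbhd e0 \<subseteq> V" using openin_contains_nbhd[OF V] .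
  \<comment> \<open>Extensions along discrete chains at scale e move inside
    \<open>nbhd (2 * e)\<close>, which must lie in V.\<close>
  define e where "e = e0 / 2"
  have e: "e > 0" "nbhd (2 * e) \<subseteq> V" "nbhd e \<subseteq> V" using e0 nbhd_mono[of e e0] by (auto simp: e_def)
  obtain U1 k1 where U1: "openin hilbert_cube U1" "X \<subseteq> U1"
    and k1: "\<forall>k\<ge>k1. homotopic_with_canon (\<lambda>_. True) U1 V (fs k) (fs (Suc k))"
    by (rule fundE[OF fs V])
  obtain U2 k2 where U2: "openin hilbert_cube U2" "X \<subseteq> U2"
    and k2: "\<forall>k\<ge>k2. homotopic_with_canon (\<lambda>_. True) U2 V (gs k) (gs (Suc k))"
    by (rule fundE[OF gs V])
  obtain k3 where k3: "\<forall>k\<ge>k3. near_on_X e (fs k) (nearest_sequence fs k) \<and> nearest_sequence fs k \<in> X \<rightarrow> Y"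
    using fund_eventually_near[OF fs e(1)] by blast
  obtain k4 where k4: "\<forall>k\<ge>k4. near_on_X e (gs k) (nearest_sequence gs k) \<and> nearest_sequence gs k \<in> X \<rightarrow> Y"
    using fund_eventually_near[OF gs e(1)] by blast
  obtain k5 where k5: "\<forall>k\<ge>k5. discrete_homotopic e (nearest_sequence fs k) (nearest_sequence gs k)"
    using eq e(1) unfolding discrete_equiv_def by blast
  define K where "K = k1 + k2 + k3 + k4 + k5"
  have K: "k1 \<le> K" "k2 \<le> K" "k3 \<le> K" "k4 \<le> K" "k5 \<le> K" by (auto simp: K_def)
  have nf: "near_on_X e (fs K) (nearest_sequence fs K)"
    and ng: "near_on_X e (gs K) (nearest_sequence gs K)" "nearest_sequence gs K \<in> X \<rightarrow> Y"
    using k3 k4 K by auto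
  obtain G where G: "continuous_on cube G" "G \<in> cube \<rightarrow> cube" "\<forall>x\<in>X. G x = gs K x" "homotopic_near (2 * e) (fs K) G"
    using homotopic_near_extension[OF k5[rule_format, OF K(5)] nf ng(1)] by blast
  have nG: "near_on_X e G (nearest_sequence gs K)" using G ng(1) by (simp add: near_on_X_def)
  obtain U3 where U3: "openin hilbert_cube U3" "X \<subseteq> U3" "homotopic_with_canon (\<lambda>_. True) U3 (nbhd e) G (gs K)"
    using homotopic_if_near[OF nG ng] .
  let ?U = "U1 \<inter> U2 \<inter> U3"
  have U1c: "U1 \<subseteq> cube" using openin_subset[OF U1(1)] by (simp add: hilbert_cube_eq)
  have "homotopic_with_canon (\<lambda>_. True) ?U V (fs k) (gs k)" if k: "K \<le> k" for k
  proof -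
    have "homotopic_with_canon (\<lambda>_. True) U1 V (fs K) (fs k)" using homotopic_chain[OF k1 K(1) k] .
    then have 1: "homotopic_with_canon (\<lambda>_. True) ?U V (fs K) (fs k)" by (rule homotopic_with_subset_left) auto
    have "fs K \<in> ?U \<rightarrow> V" using homotopic_with_imp_funspace1[OF 1] .
    moreover have "?U \<subseteq> cube" using U1c by auto
    ultimately have 2: "homotopic_with_canon (\<lambda>_. True) ?U V (fs K) G"
      using G(4) e(2) unfolding homotopic_near_def by blast
    have "homotopic_with_canon (\<lambda>_. True) ?U (nbhd e) G (gs K)"
      by (rule homotopic_with_subset_left[OF U3(3)]) auto
    then have 3: "homotopic_with_canon (\<lambda>_. True) ?U V G (gs K)" using e(3) by (rule homotopic_with_subset_right)
    have "homotopic_with_canon (\<lambda>_. True) U2 V (gs K) (gs k)" using homotopic_chain[OF k2 K(2) k] .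
    then have 4: "homotopic_with_canon (\<lambda>_. True) ?U V (gs K) (gs k)" by (rule homotopic_with_subset_left) auto
    show ?thesis
      by (rule homotopic_with_trans[OF homotopic_with_symD[OF 1] homotopic_with_trans[OF 2 homotopic_with_trans[OF 3 4]]])
  qed
  moreover have "openin hilbert_cube ?U" "X \<subseteq> ?U" using U1 U2 U3 by (auto intro: openin_Int)
  ultimately show "\<exists>U. openin hilbert_cube U \<and> X \<subseteq> U \<and>
      (\<exists>k0. \<forall>k\<ge>k0. homotopic_with_canon (\<lambda>_. True) U V (fs k) (gs k))" by blast
qed

text \<open>The maps are built by dependent choice, each extending prescribed approximate values on
  X by a homotopy from its predecessor, so that consecutive homotopies can be run over the same
  domain.\<close>

lemma nearest_sequence_surj:
  assumes v: "v \<in> discrete_sequences"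
  shows "\<exists>fs\<in>fund. (nearest_sequence fs, v) \<in> discrete_equiv"
proof -
  define e :: "nat \<Rightarrow> real" where "e n = (1/2) ^ n" for n
  have e: "e n > 0" "e (Suc n) \<le> e n" for n by (auto simp: e_def)
  have e_mono: "e m \<le> e n" if "n \<le> m" for n m using that unfolding e_def by (intro power_decreasing) auto
  have e_small: "\<exists>N. e N < c" if "c > 0" for c
    unfolding e_def using real_arch_pow_inv[of c "1/2"] that by auto
  obtain u where uv: "(u, v) \<in> discrete_equiv" and u: "\<And>n. discrete_homotopic (e n) (u n) (u (Suc n))"
    by (rule discrete_sequences_fast[OF v e(1)]) (rule that)
  have "\<exists>F. near_on_X (e n) F (u n) \<and> u n \<in> X \<rightarrow> Y" for n
    by (rule discrete_homotopic_near[OF discrete_homotopic_sym[OF u[of n]]]) blast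
  then obtain G0 where G0: "\<And>n. near_on_X (e n) (G0 n) (u n)" and uY: "\<And>n. u n \<in> X \<rightarrow> Y" by metis
  have "\<exists>gs. \<forall>n. near_on_X (e n) (gs n) (u n) \<and> homotopic_near (2 * e n) (gs n) (gs (Suc n))"
  proof (rule dependent_nat_choice)
    show "\<exists>F. near_on_X (e 0) F (u 0)" using G0 by blast
    fix F n assume F: "near_on_X (e n) F (u n)"
    have "near_on_X (e n) (G0 (Suc n)) (u (Suc n))"
      using G0[of "Suc n"] e(2)[of n] unfolding near_on_X_def by fastforce
    then obtain G where G: "continuous_on cube G" "G \<in> cube \<rightarrow> cube" "\<forall>x\<in>X. G x = G0 (Suc n) x"
      "homotopic_near (2 * e n) F G"
      using homotopic_near_extension[OF u[of n] F] by blast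
    \<comment> \<open>The homotopy has scale \<open>e n\<close>, but G agrees on X with
      \<open>G0 (Suc n)\<close>; this restores the sharper error \<open>e (Suc n)\<close> for the
      next step.\<close>
    moreover from this have "near_on_X (e (Suc n)) G (u (Suc n))"
      using G0[of "Suc n"] by (simp add: near_on_X_def)
    ultimately show "\<exists>G. near_on_X (e (Suc n)) G (u (Suc n)) \<and> homotopic_near (2 * e n) F G" by blast
  qed
  then obtain gs where gs: "\<And>n. near_on_X (e n) (gs n) (u n)"
    and hom: "\<And>n. homotopic_near (2 * e n) (gs n) (gs (Suc n))" by blast
  have cont: "continuous_on cube (gs n)" "gs n \<in> cube \<rightarrow> cube" for n
    using gs[of n] by (auto simp: near_on_X_def)
  have "gs \<in> fund"
    unfolding fund_iff
  proof (intro conjI allI impI cont; elim conjE)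
    fix V assume V: "openin hilbert_cube V" "Y \<subseteq> V"
    obtain c where c: "c > 0" "nbhd c \<subseteq> V" using openin_contains_nbhd[OF V] .
    obtain N where N: "e N < c / 2" using e_small[of "c / 2"] c(1) by auto
    have nbhd_V: "nbhd (2 * e n) \<subseteq> V" if "N \<le> n" for n
      using nbhd_mono[of "2 * e n" c] e_mono[OF that] N c(2) by auto
    \<comment> \<open>This set serves all k beyond N: \<open>gs N\<close> maps it into V, and each
      relation \<open>homotopic_near\<close> hands this property to the next map without shrinking
      the domain.\<close>
    let ?U = "cube \<inter> gs N -` V"
    have "openin hilbert_cube ?U"
      using continuous_openin_preimage[OF cont(1) cont(2), of V N] V(1) by (simp add: hilbert_cube_eq)
    moreover have "X \<subseteq> ?U"
    proof
      fix x assume x: "x \<in> X"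
      then have "dist (gs N x) (u N x) < 2 * e N" "u N x \<in> Y" "gs N x \<in> cube"
        using gs[of N] uY[of N] cont(2)[of N] X(2) e(1)[of N] by (fastforce simp: near_on_X_def)+
      then have "gs N x \<in> nbhd (2 * e N)" by (auto simp: nbhd_def)
      then show "x \<in> ?U" using nbhd_V[of N] x X(2) by auto
    qed
    moreover have "homotopic_with_canon (\<lambda>_. True) ?U V (gs k) (gs (Suc k))" if "N \<le> k" for k
    proof -
      have hom_U: "homotopic_with_canon (\<lambda>_. True) ?U V (gs k) (gs (Suc k))"
        if "gs k \<in> ?U \<rightarrow> V" "N \<le> k" for k
        by (rule hom[of k, unfolded homotopic_near_def, rule_format, OF _ that(1) nbhd_V[OF that(2)]]) simp
      have "gs k \<in> ?U \<rightarrow> V"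
        using \<open>N \<le> k\<close>
      proof (induction k rule: dec_induct)
        case (step k)
        show ?case by (rule homotopic_with_imp_funspace2[OF hom_U[OF step(3,1)]])
      qed auto
      then show ?thesis using \<open>N \<le> k\<close> by (rule hom_U)
    qed
    ultimately show "\<exists>U. openin hilbert_cube U \<and> X \<subseteq> U \<and>
        (\<exists>k0. \<forall>k\<ge>k0. homotopic_with_canon (\<lambda>_. True) U V (gs k) (gs (Suc k)))" by blast
  qed
  moreover have "(nearest_sequence gs, u) \<in> discrete_equiv"
  proof (rule discrete_equivI)
    show "u \<in> discrete_sequences" using uv by (simp add: discrete_equiv_def)
    fix c :: real assume "c > 0"
    then obtain N where N: "e N < c / 5" using e_small[of "c / 5"] by auto
    have "discrete_homotopic c (nearest_sequence gs n) (u n)" if n: "N \<le> n" for n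
    proof -
      have near: "nearest (gs n x) \<in> Y \<and> dist (nearest (gs n x)) (u n x) < 2 * e n" if x: "x \<in> X" for x
      proof -
        have "u n x \<in> Y" "dist (gs n x) (u n x) < e n" using gs[of n] uY[of n] x by (auto simp: near_on_X_def)
        moreover have "dist (nearest (gs n x)) (u n x) \<le> dist (gs n x) (nearest (gs n x)) + dist (gs n x) (u n x)"
          by (metis dist_commute dist_triangle)
        ultimately show ?thesis using nearest[of "u n x" "gs n x" "e n"] by simp
      qed
      obtain w where "contiguous (e n) (u n) w"
        using u[of n] unfolding discrete_homotopic_def by (rule converse_tranclpE) blast+
      then obtain \<delta> where \<delta>: "\<delta> > 0" "\<forall>x\<in>X. \<forall>y\<in>X. dist x y < \<delta> \<longrightarrow> dist (u n x) (u n y) < e n"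
        unfolding contiguous_def by blast
      \<comment> \<open>5 = 2 + 1 + 2: each nearest point is within \<open>2 * e n\<close> of the
        value of \<open>u n\<close>, which oscillates by less than \<open>e n\<close>.\<close>
      have "contiguous (5 * e n) (nearest_sequence gs n) (u n)"
      proof (rule contiguousI[OF _ uY \<delta>(1)])
        show "nearest_sequence gs n \<in> X \<rightarrow> Y" using near by (simp add: nearest_sequence_def)
        fix x y assume xy: "x \<in> X" "y \<in> X" "dist x y < \<delta>"
        let ?a = "nearest (gs n x)" and ?b = "nearest (gs n y)"
        have "dist (u n x) (u n y) < e n" using \<delta>(2) xy by blast
        moreover have "dist ?a (u n y) \<le> dist ?a (u n x) + dist (u n x) (u n y)" by (rule dist_triangle)
        moreover have "dist ?a ?b \<le> dist ?a (u n y) + dist ?b (u n y)" by (metis dist_commute dist_triangle)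
        ultimately show "dist (nearest_sequence gs n x) (nearest_sequence gs n y) < 5 * e n \<and>
            dist (u n x) (u n y) < 5 * e n \<and> dist (nearest_sequence gs n x) (u n y) < 5 * e n"
          using near[OF xy(1)] near[OF xy(2)] e(1)[of n] unfolding nearest_sequence_def by linarith
      qed
      moreover have "5 * e n \<le> c" using e_mono[OF n] N by simp
      ultimately show ?thesis
        by (rule contiguous_imp_discrete_homotopic[OF contiguous_mono])
    qed
    then show "\<exists>N. \<forall>n\<ge>N. discrete_homotopic c (nearest_sequence gs n) (u n)" by blast
  qed
  then have "(nearest_sequence gs, v) \<in> discrete_equiv"
    using uv equiv_discrete_equiv by (meson equiv_def transD)
  ultimately show ?thesis by blast
qed

proposition fundamental_sequences_eqpoll:
  "fundamental_sequences X Y // fs_homotopic X Y \<approx> discrete_sequences // discrete_equiv"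
proof (rule eqpoll_quotient[of _ _ _ _ nearest_sequence, OF equiv_discrete_equiv])
  show "fs_homotopic X Y \<subseteq> fund \<times> fund" by (auto simp: fs_homotopic_def)
  show "(fs, gs) \<in> fs_homotopic X Y \<longleftrightarrow> (nearest_sequence fs, nearest_sequence gs) \<in> discrete_equiv"
    if fs: "fs \<in> fund" and gs: "gs \<in> fund" for fs gs
  proof
    assume FG: "(fs, gs) \<in> fs_homotopic X Y"
    show "(nearest_sequence fs, nearest_sequence gs) \<in> discrete_equiv"
    proof (rule discrete_equivI[OF nearest_sequence_in[OF gs]])
      show "\<exists>N. \<forall>k\<ge>N. discrete_homotopic e (nearest_sequence fs k) (nearest_sequence gs k)" if "e > 0" for e
        using FG[unfolded fs_homotopic_iff] by (intro eventually_discrete_homotopic_nearest that) blast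
    qed
  qed (rule nearest_sequence_equiv_imp[OF fs gs])
qed (auto intro: nearest_sequence_in nearest_sequence_surj)

end

section \<open>Embedding into the Hilbert cube\<close>

text \<open>The coordinates are distances, cut off at 1, to an enumeration of the union of all
  \<open>A n\<close>, which is countable and dense. An injective continuous map from a compact space
  to a Hausdorff space is an embedding.\<close>

lemma (in approximated_space) embedding_hilbert_cube_exists:
  assumes "compact_space mtopology"
  shows "\<exists>e. embedding_map mtopology hilbert_cube e"
proof -
  let ?D = "\<Union>n. A n"
  define a where "a = from_nat_into ?D"
  define e where "e x = (\<lambda>i::nat. min 1 (d x (a i)))" for x
  have aM: "a i \<in> M" if "M \<noteq> {}" for i
  proof -
    have "?D \<noteq> {}" using that near_nonempty near_subset(1) by fastforce
    then have "a i \<in> ?D" unfolding a_def by (rule from_nat_into)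
    then show ?thesis using A_subset by blast
  qed
  have dense: "\<exists>i. d x (a i) < r" if x: "x \<in> M" and "r > 0" for x r
  proof -
    obtain n where "eps n < r" using eps_small[OF \<open>r > 0\<close>] by blast
    moreover obtain c where c: "c \<in> A n" "d x c < eps n"
      using near_nonempty[OF x, of n] by (auto simp: near_def)
    moreover have "\<exists>i. a i = c"
    proof -
      have "countable ?D" using finite_A by (intro countable_UN) (auto intro: countable_finite)
      then show ?thesis using c from_nat_into_surj[of ?D c] unfolding a_def by blast
    qed
    ultimately show ?thesis using less_trans by blast
  qed
  have coord: "continuous_map mtopology euclideanreal (\<lambda>x. d x (a i))" for i
  proof (cases "M = {}")
    case True
    have "topspace mtopology = {}" by (subst topspace_mtopology) (rule True)
    then show ?thesis unfolding continuous_map_def by (simp only:) simp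
  next
    case False
    have "continuous_map mtopology euclideanreal (\<lambda>x. mdist (metric (M, d)) x (a i))"
      by (rule continuous_map_mdist) (use aM[OF False] in auto)
    then show ?thesis by simp
  qed
  have "continuous_map mtopology hilbert_cube e"
    unfolding hilbert_cube_def continuous_map_in_subtopology continuous_map_componentwise_UNIV e_def
    by (auto intro!: continuous_map_real_min coord)
  moreover have "inj_on e (topspace mtopology)"
  proof (rule inj_onI, rule ccontr)
    fix x y assume "x \<in> topspace mtopology" "y \<in> topspace mtopology" and exy: "e x = e y" and "x \<noteq> y"
    then have xy: "x \<in> M" "y \<in> M" "d x y > 0" by auto
    \<comment> \<open>The bound 1/2 keeps the cut-off inactive, so equal coordinates mean equal
      distances to \<open>a i\<close>; half of \<open>d x y\<close> then contradicts the triangle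
      inequality.\<close>
    then obtain i where i: "d x (a i) < min (1/2) (d x y / 2)" using dense[of x "min (1/2) (d x y / 2)"] by auto
    have "min 1 (d x (a i)) = min 1 (d y (a i))" using fun_cong[OF exy, of i] by (simp add: e_def)
    then have "d y (a i) = d x (a i)" using i by (auto simp: min_def split: if_splits)
    moreover have "d x y \<le> d x (a i) + d y (a i)"
      using triangle[of x "a i" y] xy aM commute by (metis empty_iff)
    ultimately show False using i by simp
  qed
  moreover have "Hausdorff_space hilbert_cube"
    by (simp add: hilbert_cube_eq Hausdorff_space_subtopology)
  ultimately show ?thesis
    using assms injective_closed_imp_embedding_map continuous_imp_closed_map by blast
qed

text \<open>Existence of an embedding gives the choice in \<open>hc_embedding\<close> its meaning;
  compactness makes it and its inverse g uniformly continuous, the form needed for a change of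
  metric.\<close>

lemma (in approximated_space) hc_embedding_uniform:
  assumes compact: "compact_space mtopology"
  defines "E \<equiv> hc_embedding M d"
  obtains g where "compact (E ` M)" "E ` M \<subseteq> cube" "g \<in> E ` M \<rightarrow> M"
    "\<And>x. x \<in> M \<Longrightarrow> g (E x) = x" "\<And>z. z \<in> E ` M \<Longrightarrow> E (g z) = z"
    "\<And>e. e > 0 \<Longrightarrow> \<exists>\<delta>>0. \<forall>x\<in>M. \<forall>y\<in>M. d x y < \<delta> \<longrightarrow> dist (E x) (E y) < e"
    "\<And>e. e > 0 \<Longrightarrow> \<exists>\<delta>>0. \<forall>x\<in>E ` M. \<forall>y\<in>E ` M. dist x y < \<delta> \<longrightarrow> d (g x) (g y) < e"
proof -
  let ?Z = "E ` M"
  have emb: "embedding_map mtopology hilbert_cube E"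
    unfolding E_def hc_embedding_def by (rule someI_ex[OF embedding_hilbert_cube_exists[OF compact]])
  then have hom: "homeomorphic_map mtopology (subtopology hilbert_cube ?Z) E"
    by (simp add: embedding_map_def)
  have "?Z = topspace (subtopology hilbert_cube ?Z)"
    using homeomorphic_imp_surjective_map[OF hom] by (simp only: topspace_mtopology)
  also have "\<dots> \<subseteq> cube" by (simp add: hilbert_cube_eq)
  finally have Z: "?Z \<subseteq> cube" .
  then have top: "subtopology hilbert_cube ?Z = mtopology_of (submetric euclidean_metric ?Z)"
    by (simp add: hilbert_cube_eq subtopology_subtopology mtopology_of_submetric inf.absorb2)
  have "compact_space (subtopology hilbert_cube ?Z)"
    using homeomorphic_compact_space[OF homeomorphic_map_imp_homeomorphic_space[OF hom]] compact by blast
  then have cZ: "compact_space (mtopology_of (submetric euclidean_metric ?Z))" by (simp add: top)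
  then have "compact ?Z" using compactin_subspace[of euclidean ?Z] by (simp add: mtopology_of_submetric)
  obtain g where g: "homeomorphic_maps mtopology (subtopology hilbert_cube ?Z) E g"
    using hom by (auto simp: homeomorphic_map_maps)
  have inv: "g (E x) = x" if "x \<in> M" for x using g that by (simp add: homeomorphic_maps_def)
  have "uniformly_continuous_map (metric (M, d)) (submetric euclidean_metric ?Z) E"
    by (rule continuous_imp_uniformly_continuous_map)
      (use g compact top in \<open>simp add: homeomorphic_maps_def\<close>)
  then have E: "\<exists>\<delta>>0. \<forall>x\<in>M. \<forall>y\<in>M. d x y < \<delta> \<longrightarrow> dist (E x) (E y) < e" if "e > 0" for e
    using that unfolding uniformly_continuous_map_def by (simp add: commute dist_commute)
  have "uniformly_continuous_map (submetric euclidean_metric ?Z) (metric (M, d)) g"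
    by (rule continuous_imp_uniformly_continuous_map)
      (use g cZ top in \<open>simp add: homeomorphic_maps_def\<close>)
  then have G: "\<exists>\<delta>>0. \<forall>x\<in>?Z. \<forall>y\<in>?Z. dist x y < \<delta> \<longrightarrow> d (g x) (g y) < e" if "e > 0" for e
    using that unfolding uniformly_continuous_map_def by (simp add: commute dist_commute)
  show thesis
    by (rule that[OF \<open>compact ?Z\<close> Z _ inv _ E G]) (use inv in auto)
qed

theorem theorem4p7:
  fixes X :: "'a set" and d :: "'a \<Rightarrow> 'a \<Rightarrow> real"
    and Y :: "'b set" and l :: "'b \<Rightarrow> 'b \<Rightarrow> real"
    and epsX epsY :: "nat \<Rightarrow> real" and AX :: "nat \<Rightarrow> 'a set" and AY :: "nat \<Rightarrow> 'b set"
  assumes "Metric_space X d" and "compact_space (Metric_space.mtopology X d)"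
    and "Metric_space Y l" and "compact_space (Metric_space.mtopology Y l)"
    and "finite_approximation X d epsX AX"
    and "finite_approximation Y l epsY AY"
  shows "\<exists>\<Phi>. bij_betw \<Phi> (shape_morphisms X d Y l)
           (pro_morphisms (fa_spaces d epsX AX) (fa_bonds d epsX AX)
                          (fa_spaces l epsY AY) (fa_bonds l epsY AY))"
proof -
  interpret pair: approximated_pair X d Y l epsX AX epsY AY
    using assms by (simp add: approximated_pair_def metric_pair_def approximated_space_def
        approximated_space_axioms_def)
  let ?E = "hc_embedding X d" and ?F = "hc_embedding Y l"
  obtain g where X: "compact (?E ` X)" "?E ` X \<subseteq> cube" "g \<in> ?E ` X \<rightarrow> X"
    "\<And>x. x \<in> X \<Longrightarrow> g (?E x) = x" "\<And>z. z \<in> ?E ` X \<Longrightarrow> ?E (g z) = z"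
    "\<And>e. e > 0 \<Longrightarrow> \<exists>\<delta>>0. \<forall>x\<in>X. \<forall>y\<in>X. d x y < \<delta> \<longrightarrow> dist (?E x) (?E y) < e"
    "\<And>e. e > 0 \<Longrightarrow> \<exists>\<delta>>0. \<forall>x\<in>?E ` X. \<forall>y\<in>?E ` X. dist x y < \<delta> \<longrightarrow> d (g x) (g y) < e"
    by (rule pair.dom.hc_embedding_uniform[OF assms(2)]) (rule that)
  obtain h where Y: "compact (?F ` Y)" "?F ` Y \<subseteq> cube" "h \<in> ?F ` Y \<rightarrow> Y"
    "\<And>x. x \<in> Y \<Longrightarrow> h (?F x) = x" "\<And>z. z \<in> ?F ` Y \<Longrightarrow> ?F (h z) = z"
    "\<And>e. e > 0 \<Longrightarrow> \<exists>\<delta>>0. \<forall>x\<in>Y. \<forall>y\<in>Y. l x y < \<delta> \<longrightarrow> dist (?F x) (?F y) < e"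
    "\<And>e. e > 0 \<Longrightarrow> \<exists>\<delta>>0. \<forall>x\<in>?F ` Y. \<forall>y\<in>?F ` Y. dist x y < \<delta> \<longrightarrow> l (h x) (h y) < e"
    by (rule pair.cod.hc_embedding_uniform[OF assms(4)]) (rule that)
  interpret cube: cube_pair "?E ` X" "?F ` Y"
    by (rule cube_pair.intro[OF X(1,2) Y(1,2)])
  have "shape_morphisms X d Y l \<approx> cube.discrete_sequences // cube.discrete_equiv"
    using cube.fundamental_sequences_eqpoll by (simp add: shape_morphisms_def)
  \<comment> \<open>A function v between the embedded copies corresponds to
    \<open>h \<circ> v \<circ> ?E\<close>; in the other direction v goes to
    \<open>?F \<circ> v \<circ> g\<close>.\<close>
  moreover have "cube.discrete_sequences // cube.discrete_equiv \<approx> pair.discrete_sequences // pair.discrete_equiv"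
  proof (rule eqpoll_discrete_change_metric)
    show "metric_pair_change (?E ` X) dist (?F ` Y) dist X d Y l ?E h"
      by unfold_locales (rule funcsetI, erule imageI | rule Y(3) | erule X(6) | erule Y(7))+
    show "metric_pair_change X d Y l (?E ` X) dist (?F ` Y) dist g ?F"
      by unfold_locales (rule funcsetI, erule imageI | rule X(3) | erule X(7) | erule Y(6))+
  qed (fact X(4,5) Y(4,5))+
  ultimately have "shape_morphisms X d Y l \<approx>
      pro_morphisms (fa_spaces d epsX AX) (fa_bonds d epsX AX) (fa_spaces l epsY AY) (fa_bonds l epsY AY)"
    by (rule eqpoll_trans[OF eqpoll_trans eqpoll_sym[OF pair.pro_morphisms_eqpoll]])
  then show ?thesis by (simp only: eqpoll_def)
qed

end
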